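(* Let $0<\delta\le 2$ and let $\rho_\delta:(0,2]\to\mathbb{R}$ be a measurable kernel such that $t\mapsto (1-t)\,\rho_\delta\big(\sqrt{2(1-t)}\big)\in L^1([-1,1])$. Let $\mathcal{L}_\delta$ be the nonlocal Laplace--Beltrami operator $$\mathcal{L}_\delta u(\mathbf{x})=\int_{\mathbb{S}^2}\rho_\delta(|\mathbf{x}-\mathbf{y}|)\,[u(\mathbf{y})-u(\mathbf{x})]\,d\Omega(\mathbf{y}),\qquad \mathbf{x}\in\mathbb{S}^2 .$$ Then for all integers $\ell\ge 0$ and $-\ell\le m\le\ell$, the spherical harmonic $Y_\ell^m$ is an eigenfunction of $\mathcal{L}_\delta$: $$\mathcal{L}_\delta Y_\ell^m(\mathbf{x})=\lambda_\delta(\ell)\,Y_\ell^m(\mathbf{x})\quad\text{for all }\mathbf{x}\in\mathbb{S}^2,\qquad \lambda_\delta(\ell)=2\pi\int_{-1}^1[P_\ell(t)-1]\,\rho_\delta\big(\sqrt{2(1-t)}\big)\,dt .$$ In particular, for $-1<\alpha<1$ and the kernel given by $$\rho_\delta\big(\sqrt{2(1-t)}\big)=\frac{(1+\alpha)2^{1+\alpha}}{\pi\,\delta^{2+2\alpha}(1-t)^{1-\alpha}}\,\chi_{[0,\delta]}\big(\sqrt{2(1-t)}\big),\qquad t\in[-1,1),$$ this holds with $$\lambda_\delta(\ell)=2\pi\int_{d}^1[P_\ell(t)-1]\,\rho_\delta\big(\sqrt{2(1-t)}\big)\,dt,\qquad d=1-\delta^2/2 .$$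
   Context: $\mathbb{S}^2\subset\mathbb{R}^3$ is the unit sphere, $d\Omega$ its standard surface measure (total mass $4\pi$), $|\mathbf{x}-\mathbf{y}|$ the Euclidean distance in $\mathbb{R}^3$, so that $|\mathbf{x}-\mathbf{y}|=\sqrt{2(1-\mathbf{x}\cdot\mathbf{y})}$ on $\mathbb{S}^2$. $P_\ell$ is the Legendre polynomial of degree $\ell$ with $P_\ell(1)=1$. $\chi_{[0,\delta]}$ is the indicator function of $[0,\delta]$. In spherical coordinates ($\theta\in[0,\pi]$ colatitude, $\varphi\in[0,2\pi)$ longitude) the spherical harmonics are $$Y_\ell^m(\theta,\varphi)=\frac{e^{\mathrm{i}m\varphi}}{\sqrt{2\pi}}\,\mathrm{i}^{m+|m|}\sqrt{(\ell+\tfrac12)\frac{(\ell-m)!}{(\ell+m)!}}\,P_\ell^m(\cos\theta),$$ where $P_\ell^m$ are the associated Legendre functions (the sign convention for $P_\ell^m$ is immaterial here); they form an orthonormal basis of $L^2(\mathbb{S}^2)$. The integral defining $\mathcal{L}_\delta u(\mathbf{x})$ is understood in the principal-value sense, i.e. as $\lim_{\varepsilon\to0^+}$ of the integral over $\{\mathbf{y}\in\mathbb{S}^2:\mathbf{x}\cdot\mathbf{y}\le\cos\varepsilon\}$ (it coincides with the Lebesgue integral whenever the integrand is integrable). *)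

theory Defs
  imports "HOL-Analysis.Analysis" "HOL-Computational_Algebra.Polynomial"
begin

definition sphere_point :: "real \<Rightarrow> real \<Rightarrow> real ^ 3" where
  "sphere_point \<theta> \<phi> = vector [sin \<theta> * cos \<phi>, sin \<theta> * sin \<phi>, cos \<theta>]"

text \<open>The surface element is \<open>sin \<theta> d\<theta> d\<phi>\<close>. The completion makes every Lebesgue measurable
  function on the sphere measurable, which is needed because kernels are only assumed to be
  Lebesgue measurable.\<close>

definition sphere_measure :: "(real ^ 3) measure" where
  "sphere_measure =
     completion (distr
       (density lborel (\<lambda>(\<theta>, \<phi>). indicator ({0..pi} \<times> {0..<2 * pi}) (\<theta>, \<phi>) * ennreal (sin \<theta>)))
       (restrict_space borel (sphere 0 1))
       (\<lambda>(\<theta>, \<phi>). sphere_point \<theta> \<phi>))"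

lemma sphere_point_in_sphere: "sphere_point \<theta> \<phi> \<in> sphere 0 1"
proof -
  have "(sin \<theta> * cos \<phi>)\<^sup>2 + (sin \<theta> * sin \<phi>)\<^sup>2 + (cos \<theta>)\<^sup>2
      = (sin \<theta>)\<^sup>2 * ((cos \<phi>)\<^sup>2 + (sin \<phi>)\<^sup>2) + (cos \<theta>)\<^sup>2"
    by (simp only: power_mult_distrib distrib_left)
  also have "\<dots> = 1"
    by simp
  finally show ?thesis
    by (simp add: sphere_point_def norm_eq_sqrt_inner inner_vec_def sum_3 power2_eq_square)
qed

lemma space_sphere_measure: "space sphere_measure = sphere 0 1"
  by (simp add: sphere_measure_def space_restrict_space)

lemma measurable_sphere_point:
  "(\<lambda>(\<theta>, \<phi>). sphere_point \<theta> \<phi>) \<in> borel \<rightarrow>\<^sub>M restrict_space borel (sphere 0 1)"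
proof (rule measurable_restrict_space2)
  show "(\<lambda>(\<theta>, \<phi>). sphere_point \<theta> \<phi>) \<in> space borel \<rightarrow> sphere 0 1"
    using sphere_point_in_sphere by (auto simp: split_beta)
  have "\<forall>i. continuous_on UNIV (\<lambda>p :: real \<times> real. sphere_point (fst p) (snd p) $ i)"
    unfolding forall_3 by (simp add: sphere_point_def) (intro conjI continuous_intros)
  then have "continuous_on UNIV (\<lambda>p :: real \<times> real. sphere_point (fst p) (snd p))"
    using continuous_on_vec_lambda[of UNIV "\<lambda>i (p :: real \<times> real). sphere_point (fst p) (snd p) $ i"]
    by simp
  then show "(\<lambda>(\<theta>, \<phi>). sphere_point \<theta> \<phi>) \<in> borel_measurable borel"
    by (simp add: split_beta borel_measurable_continuous_onI)
qed

lemma emeasure_sphere_measure: "emeasure sphere_measure (sphere 0 1) = ennreal (4 * pi)"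
proof -
  let ?w = "\<lambda>(\<theta>, \<phi>). indicator ({0..pi} \<times> {0..<2 * pi}) (\<theta>, \<phi>) * ennreal (sin \<theta>)"
  have w[measurable]: "?w \<in> borel_measurable (lborel :: (real \<times> real) measure)"
    unfolding borel_prod[symmetric] lborel_prod[symmetric] by measurable
  have "(\<integral>\<^sup>+\<theta>. ennreal (sin \<theta>) * indicator {0..pi} \<theta> \<partial>lborel) = ennreal (- cos pi - (- cos 0))"
    by (rule nn_integral_FTC_Icc) (auto intro!: derivative_eq_intros sin_ge_zero)
  then have I: "(\<integral>\<^sup>+\<theta>. ennreal (sin \<theta>) * indicator {0..pi} \<theta> \<partial>lborel) = 2"
    by simp
  have "sphere 0 1 \<in> sets (restrict_space borel (sphere 0 1 :: (real ^ 3) set))"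
    by (metis sets.top space_borel space_restrict_space2 UNIV_I borel_closed closed_sphere)
  moreover have "(\<lambda>(\<theta>, \<phi>). sphere_point \<theta> \<phi>) -` sphere 0 1 = UNIV"
    using sphere_point_in_sphere by auto
  ultimately have "emeasure sphere_measure (sphere 0 1) = (\<integral>\<^sup>+p. ?w p \<partial>lborel)"
    using measurable_sphere_point
    by (simp add: sphere_measure_def emeasure_completion emeasure_distr emeasure_density w)
  also have "\<dots> = (\<integral>\<^sup>+\<theta>. \<integral>\<^sup>+\<phi>. ?w (\<theta>, \<phi>) \<partial>lborel \<partial>lborel)"
    unfolding lborel_prod[symmetric]
    by (rule lborel.nn_integral_fst[symmetric]) (use w in \<open>simp add: lborel_prod\<close>)
  also have "\<dots> = (\<integral>\<^sup>+\<theta>. (\<integral>\<^sup>+\<phi>. (ennreal (sin \<theta>) * indicator {0..pi} \<theta>) * indicator {0..<2 * pi} \<phi> \<partial>lborel) \<partial>lborel)"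
    by (intro nn_integral_cong) (auto simp: indicator_def)
  also have "\<dots> = (\<integral>\<^sup>+\<theta>. ennreal (2 * pi) * (ennreal (sin \<theta>) * indicator {0..pi} \<theta>) \<partial>lborel)"
    by (intro nn_integral_cong) (simp add: nn_integral_cmult_indicator mult.commute)
  also have "\<dots> = ennreal (2 * pi) * 2"
    by (subst nn_integral_cmult) (simp_all add: I)
  also have "\<dots> = ennreal (4 * pi)"
    by (simp flip: ennreal_numeral ennreal_mult)
  finally show ?thesis .
qed

text \<open>Rodrigues' formula.\<close>

definition legendre_poly :: "nat \<Rightarrow> real poly" where
  "legendre_poly l = smult (1 / (2 ^ l * fact l)) ((pderiv ^^ l) ([:-1, 0, 1:] ^ l))"

text \<open>Ferrers functions with the Condon--Shortley phase; negative orders are obtained from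
  \<open>P_l^{-k} = (-1)^k ((l-k)! / (l+k)!) P_l^k\<close>.\<close>

definition assoc_legendre_nonneg :: "nat \<Rightarrow> nat \<Rightarrow> real \<Rightarrow> real" where
  "assoc_legendre_nonneg l k t =
     (-1) ^ k * sqrt (1 - t\<^sup>2) ^ k * poly ((pderiv ^^ k) (legendre_poly l)) t"

definition assoc_legendre :: "nat \<Rightarrow> int \<Rightarrow> real \<Rightarrow> real" where
  "assoc_legendre l m t =
     (if 0 \<le> m then assoc_legendre_nonneg l (nat m) t
      else (-1) ^ nat (- m) * (fact (nat (int l + m)) / fact (nat (int l - m)))
             * assoc_legendre_nonneg l (nat (- m)) t)"

definition spherical_harmonic_angles :: "nat \<Rightarrow> int \<Rightarrow> real \<Rightarrow> real \<Rightarrow> complex" where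
  "spherical_harmonic_angles l m \<theta> \<phi> =
     exp (\<i> * of_int m * of_real \<phi>) / of_real (sqrt (2 * pi)) * \<i> powi (m + \<bar>m\<bar>)
       * of_real (sqrt ((real l + 1/2) * (fact (nat (int l - m)) / fact (nat (int l + m)))))
       * of_real (assoc_legendre l m (cos \<theta>))"

text \<open>At the poles the longitude is not determined by the point; there \<open>Arg2pi 0 = 0\<close> is used,
  which does not matter by \<open>spherical_harmonic_sphere_point\<close> below.\<close>

definition spherical_harmonic :: "nat \<Rightarrow> int \<Rightarrow> real ^ 3 \<Rightarrow> complex" where
  "spherical_harmonic l m x =
     spherical_harmonic_angles l m (arccos (x $ 3)) (Arg2pi (Complex (x $ 1) (x $ 2)))"

lemma spherical_harmonic_sphere_point:
  assumes "0 \<le> \<theta>" "\<theta> \<le> pi" "0 \<le> \<phi>" "\<phi> < 2 * pi"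
  shows "spherical_harmonic l m (sphere_point \<theta> \<phi>) = spherical_harmonic_angles l m \<theta> \<phi>"
proof (cases "sin \<theta> = 0")
  case True
  then have c: "(cos \<theta>)\<^sup>2 = 1"
    using sin_cos_squared_add[of \<theta>] by simp
  have "m = 0 \<or> assoc_legendre l m (cos \<theta>) = 0"
    by (auto simp: assoc_legendre_def assoc_legendre_nonneg_def c)
  then show ?thesis
    using assms by (auto simp: spherical_harmonic_def spherical_harmonic_angles_def
        sphere_point_def arccos_cos)
next
  case False
  then have "0 < sin \<theta>"
    using sin_ge_zero assms by (metis order_le_less)
  moreover have "Complex (sin \<theta> * cos \<phi>) (sin \<theta> * sin \<phi>) = of_real (sin \<theta>) * exp (\<i> * of_real \<phi>)"
    by (simp add: complex_eq_iff Re_exp Im_exp)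
  ultimately have "Arg2pi (Complex (sin \<theta> * cos \<phi>) (sin \<theta> * sin \<phi>)) = \<phi>"
    using assms by (intro Arg2pi_unique) auto
  then show ?thesis
    using assms by (simp add: spherical_harmonic_def sphere_point_def arccos_cos)
qed

definition nonlocal_LB_truncated ::
    "(real \<Rightarrow> real) \<Rightarrow> (real ^ 3 \<Rightarrow> complex) \<Rightarrow> real ^ 3 \<Rightarrow> real \<Rightarrow> complex" where
  "nonlocal_LB_truncated \<rho> u x \<epsilon> =
     (LINT y:{y \<in> sphere 0 1. x \<bullet> y \<le> cos \<epsilon>}|sphere_measure. of_real (\<rho> (dist x y)) * (u y - u x))"

text \<open>The principal value exists: all truncated integrals converge absolutely and they have a limit.
  Without this, \<open>nonlocal_LB\<close> below is an arbitrary value.\<close>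

definition nonlocal_LB_exists :: "(real \<Rightarrow> real) \<Rightarrow> (real ^ 3 \<Rightarrow> complex) \<Rightarrow> real ^ 3 \<Rightarrow> bool" where
  "nonlocal_LB_exists \<rho> u x \<longleftrightarrow>
     (\<forall>\<epsilon>. 0 < \<epsilon> \<and> \<epsilon> < pi \<longrightarrow>
        set_integrable sphere_measure {y \<in> sphere 0 1. x \<bullet> y \<le> cos \<epsilon>}
          (\<lambda>y. of_real (\<rho> (dist x y)) * (u y - u x))) \<and>
     (\<exists>v. (nonlocal_LB_truncated \<rho> u x \<longlongrightarrow> v) (at_right 0))"

definition nonlocal_LB :: "(real \<Rightarrow> real) \<Rightarrow> (real ^ 3 \<Rightarrow> complex) \<Rightarrow> real ^ 3 \<Rightarrow> complex" where
  "nonlocal_LB \<rho> u x = Lim (at_right 0) (nonlocal_LB_truncated \<rho> u x)"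

definition nonlocal_LB_eigenfunction ::
    "(real \<Rightarrow> real) \<Rightarrow> (real ^ 3 \<Rightarrow> complex) \<Rightarrow> real \<Rightarrow> bool" where
  "nonlocal_LB_eigenfunction \<rho> u c \<longleftrightarrow>
     (\<exists>x \<in> sphere 0 1. u x \<noteq> 0) \<and>
     (\<forall>x \<in> sphere 0 1. nonlocal_LB_exists \<rho> u x \<and> nonlocal_LB \<rho> u x = of_real c * u x)"

definition admissible_kernel :: "(real \<Rightarrow> real) \<Rightarrow> bool" where
  "admissible_kernel \<rho> \<longleftrightarrow>
     \<rho> \<in> borel_measurable (lebesgue_on {0<..2}) \<and>
     set_integrable lebesgue {-1..1} (\<lambda>t. (1 - t) * \<rho> (sqrt (2 * (1 - t))))"

end

theory Submission
  imports Defs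
begin

text \<open>
  The result is a consequence of the Funk--Hecke formula: for an integrable profile \<open>k\<close>,
  \<open>\<integral> k (x \<bullet> y) Y(y) d\<Omega>(y) = 2 \<pi> (\<integral> k(t) P_l(t) dt) Y(x)\<close>
  (\<open>funk_hecke\<close>). Applied to \<open>k(t) = \<rho> (sqrt (2 (1 - t)))\<close> cut off at \<open>t \<le> cos \<epsilon>\<close>, once with \<open>Y\<close> and once
  with the constant \<open>Y(x)\<close>, it gives the truncated operator as \<open>2 \<pi> Y(x)\<close> times the integral of
  \<open>k(t) (P_l(t) - 1)\<close>. Since \<open>P_l - 1\<close> is divisible by \<open>1 - t\<close>, that integrand without the cut-off
  is integrable, and dominated convergence gives the principal value.

  The Funk--Hecke formula rests on a concrete description of \<open>Y\<close>. Call a complex linear functional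
  \<open>L(y) = a \<bullet> y + \<i> (b \<bullet> y)\<close> null if its coefficient vector \<open>z = a + \<i> b\<close> satisfies
  \<open>z\<^sub>1\<^sup>2 + z\<^sub>2\<^sup>2 + z\<^sub>3\<^sup>2 = 0\<close>. Every spherical harmonic of degree \<open>l\<close> is a finite combination of powers \<open>L^l\<close> of
  null functionals (\<open>spherical_harmonic_sum_null_powers\<close>), so the formula need only be shown for
  such a power. Two facts give it. The surface measure is invariant under orthogonal maps
  (\<open>distr_orthogonal_borel_sphere_measure\<close>), so \<open>L^l\<close> may be averaged over rotations about \<open>x\<close>. And
  this average at \<open>y\<close> equals \<open>P_l (x \<bullet> y) L(x)^l\<close> (\<open>mean_rotated_null_power_axis\<close>, where \<open>x\<close> is the third
  axis), because the mean of
  \<open>(A + B cos \<psi> + C sin \<psi>)^l\<close> over \<open>\<psi>\<close> depends on \<open>B\<close> and \<open>C\<close> through \<open>B\<^sup>2 + C\<^sup>2\<close> only, and nullity of \<open>L\<close>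
  makes this \<open>- (1 - t\<^sup>2) L(x)\<^sup>2\<close> with \<open>t = x \<bullet> y\<close>; so the mean is \<open>L(x)^l\<close> times Laplace's integral for
  \<open>P_l(t)\<close>. What is left is the integral of a function of \<open>x \<bullet> y\<close> alone, which Archimedes' theorem turns
  into an integral over \<open>[-1, 1]\<close> (\<open>distr_inner_borel_sphere_measure\<close>).

  All means over the circle are finite averages over \<open>N\<close> equidistant angles with \<open>N > 2 l\<close>. For
  trigonometric polynomials of degree below \<open>N\<close> these are exact, and finite sums commute with
  everything else.
\<close>

section \<open>Sums over equidistant angles\<close>

definition node :: "nat \<Rightarrow> nat \<Rightarrow> real" where
  "node N j = 2 * pi * real j / real N"

lemma sum_cis_node:
  fixes k :: int
  assumes "\<bar>k\<bar> < int N"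
  shows "(\<Sum>j<N. cis (of_int k * node N j)) = (if k = 0 then of_nat N else 0)"
proof (cases "k = 0")
  case False
  define w where "w = cis (of_int k * (2 * pi / real N))"
  have N: "N > 0" using assms by auto
  have "w \<noteq> 1"
  proof
    assume "w = 1"
    then have "cos (of_int k * (2 * pi / real N)) = 1"
      by (simp add: w_def complex_eq_iff)
    \<comment> \<open>so \<open>N\<close> would divide \<open>k\<close>, contradicting \<open>0 < \<bar>k\<bar> < N\<close>\<close>
    then obtain n :: int where "of_int k * (2 * pi / real N) = of_int n * 2 * pi"
      unfolding cos_one_2pi_int by blast
    then have "real_of_int k = of_int (n * int N)"
      using N by (simp add: field_simps)
    then have k: "k = n * int N"
      by (simp only: of_int_eq_iff)
    with False have "\<bar>n\<bar> \<ge> 1" by auto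
    then have "\<bar>n\<bar> * int N \<ge> 1 * int N" by (intro mult_right_mono) auto
    then show False using assms k by (simp add: abs_mult)
  qed
  moreover have "w ^ N = 1"
  proof -
    have "real N * (of_int k * (2 * pi / real N)) = 2 * pi * of_int k"
      using N by simp
    then show ?thesis unfolding w_def Complex.DeMoivre by (simp only: cis_multiple_2pi Ints_of_int)
  qed
  moreover have "cis (of_int k * node N j) = w ^ j" for j
    by (simp add: w_def Complex.DeMoivre node_def mult_ac)
  ultimately show ?thesis
    using False by (simp add: sum_gp_strict)
qed simp

text \<open>With \<open>p, q = (B \<mp> \<i> C) / 2\<close> the base is \<open>p e\<^sup>i\<^sup>\<psi> + q e\<^sup>-\<^sup>i\<^sup>\<psi>\<close>; averaging its binomial expansion leaves the
  middle term, which depends on \<open>p q = (B\<^sup>2 + C\<^sup>2) / 4\<close> alone.\<close>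

lemma sum_node_trig_power:
  fixes B C :: complex
  assumes "k < N"
  shows "(\<Sum>j<N. (B * cos (node N j) + C * sin (node N j)) ^ k)
    = (if even k then of_nat N * of_nat (k choose (k div 2)) * ((B\<^sup>2 + C\<^sup>2) / 4) ^ (k div 2) else 0)"
proof -
  define p q where "p = (B - \<i> * C) / 2" and "q = (B + \<i> * C) / 2"
  have pq: "p * q = (B\<^sup>2 + C\<^sup>2) / 4"
    by (simp add: p_def q_def algebra_simps power2_eq_square)
  have term_eq: "(B * cos \<psi> + C * sin \<psi>) ^ k
      = (\<Sum>i\<le>k. of_nat (k choose i) * p ^ i * q ^ (k - i) * cis (of_int (2 * int i - int k) * \<psi>))"
    for \<psi> :: real
  proof -
    have "B * cos \<psi> + C * sin \<psi> = p * cis \<psi> + q * cis (- \<psi>)"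
      by (simp add: p_def q_def complex_eq_iff field_simps)
    moreover have "cis \<psi> ^ i * cis (- \<psi>) ^ (k - i) = cis (of_int (2 * int i - int k) * \<psi>)"
      if "i \<le> k" for i
      using that by (simp add: Complex.DeMoivre cis_mult of_nat_diff algebra_simps)
    ultimately show ?thesis
      by (simp only: binomial_ring) (intro sum.cong, auto simp: power_mult_distrib)
  qed
  have "(\<Sum>j<N. (B * cos (node N j) + C * sin (node N j)) ^ k)
      = (\<Sum>i\<le>k. of_nat (k choose i) * p ^ i * q ^ (k - i)
          * (\<Sum>j<N. cis (of_int (2 * int i - int k) * node N j)))"
    unfolding term_eq by (subst sum.swap) (simp add: sum_distrib_left)
  also have "\<dots> = (\<Sum>i\<le>k. if 2 * i = k then of_nat N * of_nat (k choose i) * p ^ i * q ^ (k - i) else 0)"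
    using assms by (intro sum.cong refl, subst sum_cis_node) auto
  also have "\<dots> = (if even k then of_nat N * of_nat (k choose (k div 2)) * (p * q) ^ (k div 2) else 0)"
  proof (cases "even k")
    case True
    then obtain r where r: "k = 2 * r" by blast
    then have "(\<Sum>i\<le>k. if 2 * i = k then of_nat N * of_nat (k choose i) * p ^ i * q ^ (k - i) else 0)
      = (\<Sum>i\<le>k. if i = r then of_nat N * of_nat (k choose i) * p ^ i * q ^ (k - i) else 0)"
      by (intro sum.cong) auto
    then show ?thesis using r by (simp add: power_mult_distrib mult_2)
  next
    case False
    then show ?thesis by (auto intro!: sum.neutral)
  qed
  finally show ?thesis unfolding pq .
qed

text \<open>For real pairs this is a phase shift. Complex pairs with equal \<open>B\<^sup>2 + C\<^sup>2\<close> need not be related by one,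
  for instance \<open>(1, \<i>)\<close> and \<open>(0, 0)\<close>, so the explicit formula for the sums is used.\<close>

lemma sum_node_trig_power_cong:
  fixes A B C B' C' :: complex
  assumes "l < N" and "B\<^sup>2 + C\<^sup>2 = B'\<^sup>2 + C'\<^sup>2"
  shows "(\<Sum>j<N. (A + B * cos (node N j) + C * sin (node N j)) ^ l)
    = (\<Sum>j<N. (A + B' * cos (node N j) + C' * sin (node N j)) ^ l)"
proof -
  have expand: "(\<Sum>j<N. (A + B * cos (node N j) + C * sin (node N j)) ^ l)
    = (\<Sum>k\<le>l. of_nat (l choose k) * (\<Sum>j<N. (B * cos (node N j) + C * sin (node N j)) ^ k) * A ^ (l - k))"
    for B C :: complex
  proof -
    have "(A + B * cos (node N j) + C * sin (node N j)) ^ l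
      = (\<Sum>k\<le>l. of_nat (l choose k) * (B * cos (node N j) + C * sin (node N j)) ^ k * A ^ (l - k))" for j
      by (subst binomial_ring[symmetric]) (simp add: add_ac)
    then show ?thesis
      by (simp only:, subst sum.swap) (simp add: sum_distrib_left sum_distrib_right)
  qed
  show ?thesis
    unfolding expand using assms by (intro sum.cong refl) (simp add: sum_node_trig_power)
qed

section \<open>Legendre polynomials and a discrete Laplace integral\<close>

lemma higher_pderiv_pcompose_shift:
  fixes p :: "'a :: idom poly"
  shows "(pderiv ^^ k) (p \<circ>\<^sub>p [:t, 1:]) = (pderiv ^^ k) p \<circ>\<^sub>p [:t, 1:]"
  by (induction k) (simp_all add: pderiv_pcompose pderiv_pCons)

text \<open>Taylor's formula: the coefficients of \<open>p (t + x)\<close> as a polynomial in \<open>x\<close>.\<close>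

lemma coeff_pcompose_shift:
  fixes p :: "real poly"
  shows "coeff (p \<circ>\<^sub>p [:t, 1:]) k = poly ((pderiv ^^ k) p) t / fact k"
proof -
  have "fact k * coeff (p \<circ>\<^sub>p [:t, 1:]) k = coeff ((pderiv ^^ k) (p \<circ>\<^sub>p [:t, 1:])) 0"
    by (simp add: coeff_higher_pderiv pochhammer_fact)
  also have "\<dots> = poly ((pderiv ^^ k) p) t"
    by (simp add: higher_pderiv_pcompose_shift poly_0_coeff_0[symmetric] poly_pcompose)
  finally show ?thesis by (simp add: field_simps)
qed

lemma map_poly_of_real_mult:
  "map_poly complex_of_real (p * q) = map_poly of_real p * map_poly of_real q"
  by (intro poly_eqI) (simp add: coeff_map_poly coeff_mult)

lemma map_poly_of_real_power:
  "map_poly complex_of_real (p ^ n) = map_poly of_real p ^ n"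
  by (induction n) (simp_all add: map_poly_of_real_mult)

lemma pcompose_shift_power: "(p ^ n) \<circ>\<^sub>p q = (p \<circ>\<^sub>p q) ^ n"
  for p q :: "'a :: comm_ring_1 poly"
  by (induction n) (simp_all add: pcompose_mult pcompose_1)

text \<open>The polynomial of Rodrigues' formula, expanded around a real point in a complex increment.\<close>

lemma power_quadratic_taylor:
  fixes t :: real and h :: complex and l :: nat
  defines "q \<equiv> [:-1, 0, 1:] ^ l :: real poly"
  shows "((t + h)\<^sup>2 - 1) ^ l = (\<Sum>k\<le>2*l. of_real (poly ((pderiv ^^ k) q) t / fact k) * h ^ k)"
proof -
  let ?r = "[:t\<^sup>2 - 1, 2 * t, 1:]"
  have q: "q \<circ>\<^sub>p [:t, 1:] = ?r ^ l"
    by (simp add: q_def pcompose_shift_power pcompose_pCons power2_eq_square)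
  have "degree (?r ^ l) = 2 * l" by (simp add: degree_power_eq)
  then have "degree (map_poly complex_of_real (?r ^ l)) = 2 * l" by (simp add: degree_map_poly)
  then have "poly (map_poly complex_of_real (?r ^ l)) h
     = (\<Sum>k\<le>2*l. of_real (coeff (?r ^ l) k) * h ^ k)"
    by (simp add: poly_altdef coeff_map_poly)
  also have "\<dots> = (\<Sum>k\<le>2*l. of_real (poly ((pderiv ^^ k) q) t / fact k) * h ^ k)"
    by (simp only: coeff_pcompose_shift[symmetric] q)
  finally show ?thesis
    by (simp add: map_poly_of_real_power map_poly_pCons poly_power algebra_simps power2_eq_square)
qed

text \<open>At \<open>t = 1\<close> or \<open>t = -1\<close> the shifted Rodrigues polynomial is \<open>x\<^sup>l (2 t + x)\<^sup>l\<close>, whose coefficient at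
  \<open>x\<^sup>l\<close> is \<open>(2 t)\<^sup>l\<close>; by Taylor's formula it is also \<open>2\<^sup>l P_l(t)\<close>.\<close>

lemma poly_legendre_poly_at_end:
  assumes "t\<^sup>2 = 1"
  shows "poly (legendre_poly l) t = t ^ l"
proof -
  let ?q = "[:-1, 0, 1:] ^ l :: real poly"
  have "?q \<circ>\<^sub>p [:t, 1:] = [:0, 2 * t, 1:] ^ l"
    using assms by (simp add: pcompose_shift_power pcompose_pCons power2_eq_square)
  also have "\<dots> = monom 1 l * [:2 * t, 1:] ^ l"
    by (simp add: monom_altdef power_mult_distrib[symmetric])
  finally have "coeff (?q \<circ>\<^sub>p [:t, 1:]) l = (2 * t) ^ l"
    by (simp add: coeff_monom_mult coeff_0_power)
  then show ?thesis
    by (simp add: coeff_pcompose_shift legendre_poly_def field_simps)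
qed

lemma poly_legendre_poly_1 [simp]: "poly (legendre_poly l) 1 = 1"
  by (simp add: poly_legendre_poly_at_end)

lemma higher_pderiv_rodrigues:
  "poly ((pderiv ^^ (l + m)) ([:-1, 0, 1:] ^ l)) t
    = 2 ^ l * fact l * poly ((pderiv ^^ m) (legendre_poly l)) t"
  by (simp add: legendre_poly_def higher_pderiv_smult add.commute[of l] funpow_add)

lemma higher_pderiv_legendre_poly_nonzero:
  assumes "m \<le> l"
  shows "(pderiv ^^ m) (legendre_poly l) \<noteq> 0"
proof -
  let ?q = "[:-1, 0, 1:] ^ l :: real poly"
  have "coeff ((pderiv ^^ (l + m)) ?q) (l - m) = pochhammer (of_nat (Suc (l - m))) (l + m) * coeff ?q (2 * l)"
    using assms by (simp add: coeff_higher_pderiv mult_2)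
  moreover have "coeff ?q (2 * l) = 1"
  proof -
    have "degree ?q = 2 * l" by (simp add: degree_power_eq)
    then show ?thesis by (metis lead_coeff_power lead_coeff_pCons(1) one_neq_zero pCons_eq_0_iff power_one lead_coeff_1 one_pCons)
  qed
  moreover have "pochhammer (real (Suc (l - m))) (l + m) > 0" by (rule pochhammer_pos) simp
  ultimately have "(pderiv ^^ (l + m)) ?q \<noteq> 0" by auto
  then show ?thesis
    by (auto simp: legendre_poly_def higher_pderiv_smult add.commute[of l] funpow_add)
qed

text \<open>Laplace's integral for the associated Legendre functions, with the integral over the circle replaced
  by an exact finite sum. For \<open>h = \<i> s e\<^sup>i\<^sup>\<psi>\<close> one has
  \<open>(t + h)\<^sup>2 - 1 = 2 h (t + \<i> s cos \<psi>)\<close>, so the Taylor expansion of \<open>((t + h)\<^sup>2 - 1)\<^sup>l\<close> in \<open>h\<close> is the Fourier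
  expansion of \<open>(t + \<i> s cos \<psi>)\<^sup>l\<close>, and its coefficients are the derivatives in Rodrigues' formula. The
  sign \<open>\<sigma>\<close> selects the Fourier coefficient of order \<open>m\<close> or \<open>- m\<close>; both agree since the function is
  even in \<open>\<psi>\<close>.\<close>

lemma laplace_integral_discrete:
  fixes s t \<phi> :: real and \<sigma> :: int
  assumes st: "s\<^sup>2 + t\<^sup>2 = 1" and \<sigma>: "\<sigma>\<^sup>2 = 1" and "m \<le> l" and "2 * l < N"
  shows "(\<Sum>j<N. cis (of_int (\<sigma> * int m) * node N j) * (t + \<i> * s * cos (\<phi> - node N j)) ^ l)
    = of_nat N * (fact l / fact (l + m)) * (\<i> * s) ^ m
        * of_real (poly ((pderiv ^^ m) (legendre_poly l)) t) * cis (of_int (\<sigma> * int m) * \<phi>)"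
\<comment> \<open>the Fourier expansion divides by \<open>s\<close>, so the poles are treated separately\<close>
proof (cases "s = 0")
  case True
  have m: "\<bar>\<sigma> * int m\<bar> < int N"
    using \<sigma> assms by (auto simp: power2_eq_1_iff)
  have "(\<Sum>j<N. cis (of_int (\<sigma> * int m) * node N j) * (t + \<i> * s * cos (\<phi> - node N j)) ^ l)
      = (\<Sum>j<N. cis (of_int (\<sigma> * int m) * node N j)) * of_real t ^ l"
    using True by (simp add: sum_distrib_right)
  also have "\<dots> = (if m = 0 then of_nat N * of_real t ^ l else 0)"
    using \<sigma> by (subst sum_cis_node[OF m]) auto
  finally show ?thesis
    using True st by (simp add: poly_legendre_poly_at_end)
next
  case False
  define c where "c = (\<lambda>k. poly ((pderiv ^^ k) ([:-1, 0, 1:] ^ l)) t / fact k)"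
  have expand: "(t + \<i> * s * cos \<psi>) ^ l
      = (\<Sum>k\<le>2*l. of_real (c k) * (\<i> * s) ^ k / (2 * \<i> * s) ^ l * cis (of_int (int k - int l) * \<psi>))" for \<psi> :: real
  proof -
    define h where "h = \<i> * s * cis \<psi>"
    have "(t + h)\<^sup>2 - 1 = (2 * \<i> * s * cis \<psi>) * (t + \<i> * s * cos \<psi>)"
    proof -
      have "(of_real t)\<^sup>2 - 1 = - (complex_of_real s)\<^sup>2"
        using st by (metis (no_types, lifting) add_diff_cancel_right' minus_diff_eq of_real_1 of_real_add of_real_power)
      moreover have "2 * of_real (cos \<psi>) = cis \<psi> + cis (- \<psi>)" by (simp add: complex_eq_iff)
      moreover have "cis \<psi> * cis (- \<psi>) = 1" by (simp add: cis_mult)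
      moreover have "\<i> * \<i> = - 1" by simp
      ultimately show ?thesis
        unfolding h_def power2_eq_square by algebra
    qed
    then have "(2 * \<i> * s * cis \<psi>) ^ l * (t + \<i> * s * cos \<psi>) ^ l = (\<Sum>k\<le>2*l. of_real (c k) * h ^ k)"
      using power_quadratic_taylor[of t h l] by (simp add: c_def power_mult_distrib)
    moreover have "(2 * \<i> * s * cis \<psi>) ^ l \<noteq> 0" using False by simp
    ultimately have "(t + \<i> * s * cos \<psi>) ^ l
      = (\<Sum>k\<le>2*l. of_real (c k) * h ^ k / (2 * \<i> * s * cis \<psi>) ^ l)"
      by (simp add: field_simps flip: sum_divide_distrib)
    also have "\<dots> = (\<Sum>k\<le>2*l. of_real (c k) * (\<i> * s) ^ k / (2 * \<i> * s) ^ l * cis (of_int (int k - int l) * \<psi>))"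
    proof (intro sum.cong refl)
      fix k
      have "cis (of_int (int k - int l) * \<psi>) = cis \<psi> ^ k / cis \<psi> ^ l"
        by (simp add: Complex.DeMoivre cis_divide algebra_simps)
      then show "of_real (c k) * h ^ k / (2 * \<i> * s * cis \<psi>) ^ l
         = of_real (c k) * (\<i> * s) ^ k / (2 * \<i> * s) ^ l * cis (of_int (int k - int l) * \<psi>)"
        by (simp add: h_def power_mult_distrib)
    qed
    finally show ?thesis .
  qed
  have cis_eq: "cis (of_int (\<sigma> * int m) * node N j) * cis (of_int (int k - int l) * (\<sigma> * (\<phi> - node N j)))
     = cis (of_int ((int k - int l) * \<sigma>) * \<phi>) * cis (of_int (\<sigma> * (int m + int l - int k)) * node N j)" for k j
    by (simp add: cis_mult algebra_simps)
  have cos_eq: "cos (\<phi> - x) = cos (\<sigma> * (\<phi> - x))" for x :: real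
    using \<sigma> by (auto simp: power2_eq_1_iff) (metis cos_minus minus_diff_eq)
  have "(\<Sum>j<N. cis (of_int (\<sigma> * int m) * node N j) * (t + \<i> * s * cos (\<phi> - node N j)) ^ l)
    = (\<Sum>j<N. \<Sum>k\<le>2*l. of_real (c k) * (\<i> * s) ^ k / (2 * \<i> * s) ^ l *
        (cis (of_int (\<sigma> * int m) * node N j) * cis (of_int (int k - int l) * (\<sigma> * (\<phi> - node N j)))))"
    unfolding cos_eq expand by (simp add: sum_distrib_left mult_ac)
  also have "\<dots> = (\<Sum>k\<le>2*l. of_real (c k) * (\<i> * s) ^ k / (2 * \<i> * s) ^ l * cis (of_int ((int k - int l) * \<sigma>) * \<phi>) *
        (\<Sum>j<N. cis (of_int (\<sigma> * (int m + int l - int k)) * node N j)))"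
    unfolding cis_eq by (subst sum.swap) (simp add: sum_distrib_left sum_divide_distrib mult_ac)
  also have "\<dots> = (\<Sum>k\<le>2*l. if k = l + m then of_real (c k) * (\<i> * s) ^ k / (2 * \<i> * s) ^ l * cis (of_int ((int k - int l) * \<sigma>) * \<phi>) * of_nat N else 0)"
  proof (intro sum.cong refl)
    fix k assume "k \<in> {..2*l}"
    then have "\<bar>\<sigma> * (int m + int l - int k)\<bar> < int N"
      using \<sigma> assms by (auto simp: power2_eq_1_iff)
    from sum_cis_node[OF this]
    have "(\<Sum>j<N. cis (of_int (\<sigma> * (int m + int l - int k)) * node N j)) = (if k = l + m then of_nat N else 0)"
      using \<sigma> by auto
    then show "of_real (c k) * (\<i> * s) ^ k / (2 * \<i> * s) ^ l * cis (of_int ((int k - int l) * \<sigma>) * \<phi>) *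
        (\<Sum>j<N. cis (of_int (\<sigma> * (int m + int l - int k)) * node N j))
      = (if k = l + m then of_real (c k) * (\<i> * s) ^ k / (2 * \<i> * s) ^ l * cis (of_int ((int k - int l) * \<sigma>) * \<phi>) * of_nat N else 0)"
      by simp
  qed
  also have "\<dots> = of_real (c (l + m)) * ((\<i> * s) ^ (l + m) / (2 * \<i> * s) ^ l) * cis (of_int (\<sigma> * int m) * \<phi>) * of_nat N"
    using \<open>m \<le> l\<close> by (simp add: mult.commute)
  also have "(\<i> * s) ^ (l + m) / (2 * \<i> * s) ^ l = (\<i> * s) ^ m / 2 ^ l"
    using False by (simp add: power_add power_mult_distrib field_simps)
  also have "of_real (c (l + m)) = (2 ^ l * fact l * of_real (poly ((pderiv ^^ m) (legendre_poly l)) t) / fact (l + m) :: complex)"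
    by (simp add: c_def higher_pderiv_rodrigues)
  finally show ?thesis
    by (simp add: field_simps)
qed

section \<open>Powers of null functionals and their means over circles of latitude\<close>

text \<open>The complex linear functional with coefficient vector \<open>a + \<i> b\<close>. The real pair \<open>(a, b)\<close> is kept because
  orthogonal maps act on it.\<close>

definition null_functional :: "(real ^ 3) \<Rightarrow> (real ^ 3) \<Rightarrow> real ^ 3 \<Rightarrow> complex" where
  "null_functional a b y = Complex (a \<bullet> y) (b \<bullet> y)"

text \<open>Equivalently, the squares of the entries of \<open>a + \<i> b\<close> sum to \<open>0\<close>.\<close>

definition null_pair :: "(real ^ 3) \<Rightarrow> (real ^ 3) \<Rightarrow> bool" where
  "null_pair a b \<longleftrightarrow> norm a = norm b \<and> a \<bullet> b = 0"

definition axis_rotation :: "real \<Rightarrow> real ^ 3 \<Rightarrow> real ^ 3" where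
  "axis_rotation \<psi> y = vector [cos \<psi> * y $ 1 - sin \<psi> * y $ 2, sin \<psi> * y $ 1 + cos \<psi> * y $ 2, y $ 3]"

lemma orthogonal_transformation_axis_rotation: "orthogonal_transformation (axis_rotation \<psi>)"
  unfolding orthogonal_transformation_def
proof
  show "linear (axis_rotation \<psi>)"
    by (rule linearI) (simp_all add: axis_rotation_def vec_eq_iff forall_3 algebra_simps)
  have "axis_rotation \<psi> v \<bullet> axis_rotation \<psi> w
      = ((cos \<psi>)\<^sup>2 + (sin \<psi>)\<^sup>2) * (v $ 1 * w $ 1 + v $ 2 * w $ 2) + v $ 3 * w $ 3" for v w
    by (simp only: axis_rotation_def inner_vec_def sum_3 vector_3 inner_real_def) algebra
  then show "\<forall>v w. axis_rotation \<psi> v \<bullet> axis_rotation \<psi> w = v \<bullet> w"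
    by (simp add: inner_vec_def sum_3)
qed

lemma null_functional_orthogonal:
  assumes "orthogonal_transformation f"
  shows "null_functional a b (f y) = null_functional (inv f a) (inv f b) y"
proof -
  have "c \<bullet> f y = inv f c \<bullet> y" for c
  proof -
    have "f (inv f c) = c"
      using orthogonal_transformation_surj[OF assms] by (rule surj_f_inv_f)
    moreover have "f (inv f c) \<bullet> f y = inv f c \<bullet> y"
      using assms unfolding orthogonal_transformation_def by blast
    ultimately show ?thesis by simp
  qed
  then show ?thesis by (simp add: null_functional_def)
qed

lemma null_pair_orthogonal:
  assumes "orthogonal_transformation f" "null_pair a b"
  shows "null_pair (inv f a) (inv f b)"
proof -
  have o: "orthogonal_transformation (inv f)"
    using assms(1) by (rule orthogonal_transformation_inv)
  then have "norm (inv f c) = norm c" "inv f a \<bullet> inv f b = a \<bullet> b" for c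
    by (rule orthogonal_transformation_norm, use o in \<open>simp only: orthogonal_transformation_def\<close>)
  then show ?thesis using assms(2) by (simp only: null_pair_def)
qed

text \<open>On the circle of latitude through \<open>y\<close> the functional has the form \<open>A + B cos \<psi> + C sin \<psi>\<close> with
  \<open>A = y\<^sub>3 L(e\<^sub>3)\<close>, and nullity gives \<open>B\<^sup>2 + C\<^sup>2 = (\<i> s L(e\<^sub>3))\<^sup>2\<close> with \<open>s\<^sup>2 = 1 - y\<^sub>3\<^sup>2\<close>. The pair \<open>(B, C)\<close> may therefore be
  replaced by \<open>(\<i> s L(e\<^sub>3), 0)\<close>, and \<open>L(e\<^sub>3)\<^sup>l\<close> factors out of the mean.\<close>

lemma mean_rotated_null_power_axis:
  fixes y :: "real ^ 3"
  assumes ab: "null_pair a b" and y: "norm y = 1" and N: "2 * l < N"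
  shows "(\<Sum>j<N. null_functional a b (axis_rotation (node N j) y) ^ l)
    = of_nat N * of_real (poly (legendre_poly l) (y $ 3)) * null_functional a b (axis 3 1) ^ l"
proof -
  let ?L = "null_functional a b"
  define z where "z i = Complex (a $ i) (b $ i)" for i
  have z3: "?L (axis 3 1) = z 3" by (simp add: null_functional_def z_def inner_axis)
  have null: "(z 1)\<^sup>2 + (z 2)\<^sup>2 + (z 3)\<^sup>2 = 0"
  proof -
    have "a \<bullet> a = b \<bullet> b" "a \<bullet> b = 0"
      using ab by (simp_all add: null_pair_def norm_eq)
    then show ?thesis
      by (simp add: z_def complex_eq_iff power2_eq_square inner_vec_def sum_3 algebra_simps)
  qed
  define s where "s = sqrt (1 - (y $ 3)\<^sup>2)"
  have y2: "(y $ 1)\<^sup>2 + (y $ 2)\<^sup>2 + (y $ 3)\<^sup>2 = 1"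
    using y by (simp add: norm_vec_def L2_set_def sum_3)
  then have "0 \<le> 1 - (y $ 3)\<^sup>2" by (smt (verit) zero_le_power2)
  then have s: "s\<^sup>2 = 1 - (y $ 3)\<^sup>2" by (simp add: s_def)
  then have sc: "(complex_of_real s)\<^sup>2 = 1 - (of_real (y $ 3))\<^sup>2"
    by (metis of_real_1 of_real_diff of_real_power)
  have yc: "(complex_of_real (y $ 1))\<^sup>2 + (of_real (y $ 2))\<^sup>2 = 1 - (of_real (y $ 3))\<^sup>2"
    using y2 by (metis (no_types, lifting) add_diff_cancel_right' of_real_1 of_real_add of_real_diff of_real_power)
  define B C where "B = z 1 * y $ 1 + z 2 * y $ 2" and "C = z 2 * y $ 1 - z 1 * y $ 2"
  have BC: "B\<^sup>2 + C\<^sup>2 = (\<i> * s * z 3)\<^sup>2 + 0\<^sup>2"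
  proof -
    have "B\<^sup>2 + C\<^sup>2 = ((z 1)\<^sup>2 + (z 2)\<^sup>2) * ((of_real (y $ 1))\<^sup>2 + (of_real (y $ 2))\<^sup>2)"
      by (simp add: B_def C_def power2_eq_square algebra_simps)
    also have "(z 1)\<^sup>2 + (z 2)\<^sup>2 = - (z 3)\<^sup>2" using null by (simp add: eq_neg_iff_add_eq_0)
    finally show ?thesis unfolding yc sc[symmetric] by (simp add: power_mult_distrib)
  qed
  have "?L (axis_rotation \<psi> y) = z 3 * y $ 3 + B * cos \<psi> + C * sin \<psi>" for \<psi>
    by (simp add: null_functional_def z_def B_def C_def axis_rotation_def complex_eq_iff inner_vec_def sum_3 algebra_simps)
  then have "(\<Sum>j<N. ?L (axis_rotation (node N j) y) ^ l)
    = (\<Sum>j<N. (z 3 * y $ 3 + B * cos (node N j) + C * sin (node N j)) ^ l)" by simp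
  also have "\<dots> = (\<Sum>j<N. (z 3 * y $ 3 + (\<i> * s * z 3) * cos (node N j) + 0 * of_real (sin (node N j))) ^ l)"
    using N BC by (intro sum_node_trig_power_cong) auto
  also have "\<dots> = z 3 ^ l * (\<Sum>j<N. (y $ 3 + \<i> * s * cos (0 - node N j)) ^ l)"
    unfolding sum_distrib_left power_mult_distrib[symmetric] by (simp add: algebra_simps)
  also have "(\<Sum>j<N. (y $ 3 + \<i> * s * cos (0 - node N j)) ^ l) = of_nat N * of_real (poly (legendre_poly l) (y $ 3))"
    using laplace_integral_discrete[of s "y $ 3" 1 0 l N 0] s N by simp
  finally show ?thesis unfolding z3 by (simp add: mult_ac)
qed

section \<open>Spherical harmonics as combinations of powers of null functionals\<close>

lemma sphere_point_of_sphere: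
  fixes y :: "real ^ 3"
  assumes "norm y = 1"
  shows "sphere_point (arccos (y $ 3)) (Arg2pi (Complex (y $ 1) (y $ 2))) = y"
proof -
  let ?z = "Complex (y $ 1) (y $ 2)"
  have n: "(y $ 1)\<^sup>2 + (y $ 2)\<^sup>2 + (y $ 3)\<^sup>2 = 1"
    using assms by (simp add: norm_vec_def L2_set_def sum_3)
  then have "(y $ 3)\<^sup>2 \<le> 1"
    by (smt (verit) zero_le_power2)
  then have b: "-1 \<le> y $ 3" "y $ 3 \<le> 1"
    by (auto simp: abs_square_le_1 abs_le_iff)
  have "sin (arccos (y $ 3)) = norm ?z"
    using b n by (simp add: sin_arccos complex_norm algebra_simps)
  moreover have "norm ?z * cos (Arg2pi ?z) = y $ 1" "norm ?z * sin (Arg2pi ?z) = y $ 2"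
    using Arg2pi_eq[of ?z] by (simp_all add: complex_eq_iff Re_exp Im_exp)
  ultimately show ?thesis
    using b by (simp add: vec_eq_iff forall_3 sphere_point_def)
qed

definition harmonic_direction :: "real \<Rightarrow> real ^ 3" where
  "harmonic_direction \<psi> = vector [cos \<psi>, sin \<psi>, 0]"

lemma null_pair_harmonic_direction: "null_pair (axis 3 1) (harmonic_direction \<psi>)"
proof -
  have "norm (harmonic_direction \<psi>) = 1"
    by (simp add: harmonic_direction_def norm_vec_def L2_set_def sum_3)
  then show ?thesis
    by (simp add: null_pair_def inner_axis') (simp add: harmonic_direction_def)
qed

lemma null_functional_sphere_point:
  "null_functional (axis 3 1) (harmonic_direction \<psi>) (sphere_point \<theta> \<phi>)
    = of_real (cos \<theta>) + \<i> * of_real (sin \<theta>) * of_real (cos (\<phi> - \<psi>))"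
  by (simp add: null_functional_def harmonic_direction_def sphere_point_def complex_eq_iff inner_axis'
      inner_vec_def sum_3 axis_def cos_diff algebra_simps)

text \<open>The factors of a spherical harmonic that do not depend on the point.\<close>

definition harmonic_coeff :: "nat \<Rightarrow> int \<Rightarrow> complex" where
  "harmonic_coeff l m =
     (if 0 \<le> m then (-1) ^ nat m else fact (nat (int l + m)) / fact (nat (int l - m)))
       * of_real (sqrt ((real l + 1/2) * (fact (nat (int l - m)) / fact (nat (int l + m)))))
       * \<i> powi (m + \<bar>m\<bar>) / of_real (sqrt (2 * pi))"

lemma harmonic_coeff_nonzero: "harmonic_coeff l m \<noteq> 0"
  by (simp add: harmonic_coeff_def)

lemma spherical_harmonic_angles_eq:
  assumes "0 \<le> \<theta>" "\<theta> \<le> pi"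
  shows "spherical_harmonic_angles l m \<theta> \<phi>
    = harmonic_coeff l m * of_real (sin \<theta>) ^ nat \<bar>m\<bar>
        * of_real (poly ((pderiv ^^ nat \<bar>m\<bar>) (legendre_poly l)) (cos \<theta>)) * cis (of_int m * \<phi>)"
proof -
  have "sqrt (1 - (cos \<theta>)\<^sup>2) = sin \<theta>"
    using assms sin_ge_zero by (simp add: sin_squared_eq[symmetric])
  moreover have "exp (\<i> * of_int m * of_real \<phi>) = cis (of_int m * \<phi>)"
    by (simp add: cis_conv_exp mult_ac)
  ultimately show ?thesis
    by (simp add: spherical_harmonic_angles_def assoc_legendre_def assoc_legendre_nonneg_def harmonic_coeff_def
        minus_one_power_iff)
qed

text \<open>The constant by which the discrete Laplace integral must be multiplied to produce the spherical
  harmonic, times the Fourier weight that selects the order \<open>m\<close>.\<close>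

definition harmonic_weight :: "nat \<Rightarrow> int \<Rightarrow> nat \<Rightarrow> complex" where
  "harmonic_weight l m j = harmonic_coeff l m * fact (l + nat \<bar>m\<bar>)
     / (of_nat (2 * l + 1) * fact l * \<i> ^ nat \<bar>m\<bar>) * cis (of_int m * node (2 * l + 1) j)"

lemma spherical_harmonic_sum_null_powers:
  assumes "\<bar>m\<bar> \<le> int l" and x: "norm x = 1"
  shows "spherical_harmonic l m x = (\<Sum>j<2 * l + 1. harmonic_weight l m j
      * null_functional (axis 3 1) (harmonic_direction (node (2 * l + 1) j)) x ^ l)"
proof -
  define \<theta> \<phi> where "\<theta> = arccos (x $ 3)" and "\<phi> = Arg2pi (Complex (x $ 1) (x $ 2))"
  have "0 \<le> \<theta>" "\<theta> \<le> pi"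
    using component_le_norm_cart[of x 3] x by (auto simp: \<theta>_def intro!: arccos_lbound arccos_ubound)
  define k where "k = nat \<bar>m\<bar>"
  have k: "k \<le> l" using assms by (simp add: k_def)
  define \<sigma> where "\<sigma> = (if 0 \<le> m then 1 else - 1 :: int)"
  have \<sigma>: "\<sigma>\<^sup>2 = 1" "\<sigma> * int k = m" by (auto simp: \<sigma>_def k_def)
  have "(\<Sum>j<2 * l + 1. cis (of_int m * node (2 * l + 1) j)
        * null_functional (axis 3 1) (harmonic_direction (node (2 * l + 1) j)) x ^ l)
     = (\<Sum>j<2 * l + 1. cis (of_int m * node (2 * l + 1) j)
        * (of_real (cos \<theta>) + \<i> * of_real (sin \<theta>) * of_real (cos (\<phi> - node (2 * l + 1) j))) ^ l)"
    unfolding null_functional_sphere_point[symmetric] \<theta>_def \<phi>_def sphere_point_of_sphere[OF x] ..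
  also have "\<dots> = of_nat (2 * l + 1) * (fact l / fact (l + k)) * (\<i> * of_real (sin \<theta>)) ^ k
        * of_real (poly ((pderiv ^^ k) (legendre_poly l)) (cos \<theta>)) * cis (of_int m * \<phi>)"
    using laplace_integral_discrete[of "sin \<theta>" "cos \<theta>" \<sigma> k l "2 * l + 1" \<phi>] \<sigma> k by simp
  finally have eq: "(\<Sum>j<2 * l + 1. cis (of_int m * node (2 * l + 1) j)
        * null_functional (axis 3 1) (harmonic_direction (node (2 * l + 1) j)) x ^ l) = \<dots>" .
  have "(\<Sum>j<2 * l + 1. harmonic_weight l m j
      * null_functional (axis 3 1) (harmonic_direction (node (2 * l + 1) j)) x ^ l)
    = harmonic_coeff l m * fact (l + k) / (of_nat (2 * l + 1) * fact l * \<i> ^ k)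
      * (of_nat (2 * l + 1) * (fact l / fact (l + k)) * (\<i> * of_real (sin \<theta>)) ^ k
        * of_real (poly ((pderiv ^^ k) (legendre_poly l)) (cos \<theta>)) * cis (of_int m * \<phi>))"
    unfolding eq[symmetric] sum_distrib_left by (simp add: harmonic_weight_def k_def mult_ac)
  also have "\<dots> = harmonic_coeff l m * of_real (sin \<theta>) ^ k
        * of_real (poly ((pderiv ^^ k) (legendre_poly l)) (cos \<theta>)) * cis (of_int m * \<phi>)"
    using of_nat_neq_0[of "2 * l", where 'a = complex] by (simp add: power_mult_distrib del: of_nat_Suc of_nat_add)
  also have "\<dots> = spherical_harmonic l m x"
    using \<open>0 \<le> \<theta>\<close> \<open>\<theta> \<le> pi\<close>
    by (simp add: spherical_harmonic_def spherical_harmonic_angles_eq k_def flip: \<theta>_def \<phi>_def)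
  finally show ?thesis ..
qed

text \<open>The derivative of order \<open>\<bar>m\<bar>\<close> of \<open>P_l\<close> is a nonzero polynomial, hence nonzero at some interior point of
  \<open>[-1, 1]\<close>, and there the power of \<open>sin \<theta>\<close> does not vanish.\<close>

lemma spherical_harmonic_nonzero:
  assumes "\<bar>m\<bar> \<le> int l"
  shows "\<exists>x\<in>sphere 0 1. spherical_harmonic l m x \<noteq> 0"
proof -
  let ?p = "(pderiv ^^ nat \<bar>m\<bar>) (legendre_poly l)"
  have "finite {t. poly ?p t = 0}"
    using assms by (intro poly_roots_finite higher_pderiv_legendre_poly_nonzero) simp
  then have "infinite ({-1<..<1} - {t. poly ?p t = 0})"
    by (intro Diff_infinite_finite infinite_Ioo) auto
  then have "{-1<..<1} - {t. poly ?p t = 0} \<noteq> {}"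
    by (intro notI) simp
  then obtain t where "t \<in> {-1<..<1} - {t. poly ?p t = 0}"
    by blast
  then have t: "-1 < t" "t < 1" "poly ?p t \<noteq> 0"
    by simp_all
  define \<theta> where "\<theta> = arccos t"
  have \<theta>: "0 \<le> \<theta>" "\<theta> \<le> pi" "cos \<theta> = t" "sin \<theta> \<noteq> 0"
    using t by (auto simp: \<theta>_def arccos_lbound arccos_ubound sin_arccos_nonzero)
  have "spherical_harmonic l m (sphere_point \<theta> 0) \<noteq> 0"
    using \<theta> t by (subst spherical_harmonic_sphere_point) (auto simp: spherical_harmonic_angles_eq harmonic_coeff_nonzero)
  then show ?thesis using sphere_point_in_sphere by blast
qed

section \<open>Spherical coordinates\<close>

definition angle_measure :: "(real \<times> real) measure" where
  "angle_measure = density lborel (\<lambda>(\<theta>, \<phi>). indicator ({0..pi} \<times> {0..<2 * pi}) (\<theta>, \<phi>) * ennreal (sin \<theta>))"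

text \<open>The surface measure before completion, regarded as a measure on the Borel sets of the whole space so
  that orthogonal maps of the space can be applied to it.\<close>

definition borel_sphere_measure :: "(real ^ 3) measure" where
  "borel_sphere_measure = distr angle_measure borel (\<lambda>(\<theta>, \<phi>). sphere_point \<theta> \<phi>)"

lemma sets_borel_sphere_measure [simp, measurable_cong]: "sets borel_sphere_measure = sets borel"
  and space_borel_sphere_measure [simp]: "space borel_sphere_measure = UNIV"
  by (simp_all add: borel_sphere_measure_def)

lemma sets_angle_measure [simp, measurable_cong]: "sets angle_measure = sets borel"
  and space_angle_measure [simp]: "space angle_measure = UNIV"
  by (simp_all add: angle_measure_def)

lemma borel_measurable_sphere_point [measurable]:
  "(\<lambda>(\<theta>, \<phi>). sphere_point \<theta> \<phi>) \<in> borel_measurable borel"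
  using measurable_sphere_point by (simp add: measurable_restrict_space2_iff)

lemma borel_measurable_angle_density [measurable]:
  "(\<lambda>(\<theta>, \<phi>). indicator ({0..pi} \<times> {0..<2 * pi}) (\<theta>, \<phi>) * ennreal (sin \<theta>))
     \<in> borel_measurable (borel :: (real \<times> real) measure)"
  unfolding borel_prod[symmetric] by measurable

lemma emeasure_borel_sphere_measure:
  assumes [measurable]: "A \<in> sets borel"
  shows "emeasure borel_sphere_measure A
    = (\<integral>\<^sup>+p. indicator ({0..pi} \<times> {0..<2 * pi}) p * ennreal (sin (fst p)) * indicator A (sphere_point (fst p) (snd p)) \<partial>lborel)"
proof -
  have "(\<lambda>(\<theta>, \<phi>). sphere_point \<theta> \<phi>) -` A \<in> sets borel"
    using measurable_sets[OF borel_measurable_sphere_point assms] by simp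
  then show ?thesis
    by (simp add: borel_sphere_measure_def angle_measure_def emeasure_distr emeasure_density)
      (auto intro!: nn_integral_cong simp: indicator_def split_beta)
qed

lemma emeasure_lborel_Times:
  fixes A :: "'a :: euclidean_space set" and B :: "'b :: euclidean_space set"
  assumes "A \<in> sets borel" "B \<in> sets borel"
  shows "emeasure lborel (A \<times> B) = emeasure lborel A * emeasure lborel B"
  using assms by (subst lborel_prod[symmetric]) (simp add: lborel.emeasure_pair_measure_Times)

lemma borel_measurable_vec3 [measurable]:
  "(\<lambda>(a :: real, b :: real, c :: real). vector [a, b, c] :: real ^ 3) \<in> borel_measurable borel"
proof -
  have "\<forall>i. continuous_on UNIV (\<lambda>p :: real \<times> real \<times> real. (vector [fst p, fst (snd p), snd (snd p)] :: real ^ 3) $ i)"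
    unfolding forall_3 by simp (intro conjI continuous_intros)
  then have "continuous_on UNIV (\<lambda>p :: real \<times> real \<times> real. vector [fst p, fst (snd p), snd (snd p)] :: real ^ 3)"
    using continuous_on_vec_lambda[of UNIV "\<lambda>i (p :: real \<times> real \<times> real). (vector [fst p, fst (snd p), snd (snd p)] :: real ^ 3) $ i"]
    by simp
  then show ?thesis
    by (simp add: split_beta borel_measurable_continuous_onI)
qed

text \<open>Vectors with three entries and nested pairs carry the same Lebesgue measure; this gives access to
  Fubini's theorem after the change of variables on \<open>real ^ 3\<close>.\<close>

lemma lborel_vec3:
  "(lborel :: (real ^ 3) measure)
    = distr (lborel :: (real \<times> real \<times> real) measure) borel (\<lambda>(a, b, c). vector [a, b, c])"
proof (rule lborel_eqI)
  fix l u :: "real ^ 3"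
  assume le: "\<And>b. b \<in> Basis \<Longrightarrow> l \<bullet> b \<le> u \<bullet> b"
  have le': "l $ i \<le> u $ i" for i
    using le[of "axis i 1"] by (simp add: inner_axis)
  have "(\<lambda>(a, b, c). vector [a, b, c]) -` box l u
      = {l $ 1<..<u $ 1} \<times> ({l $ 2<..<u $ 2} \<times> {l $ 3<..<u $ 3})"
    by (auto simp: mem_box_cart forall_3)
  then have "emeasure (distr (lborel :: (real \<times> real \<times> real) measure) borel (\<lambda>(a, b, c). vector [a, b, c])) (box l u)
     = emeasure (lborel :: (real \<times> real \<times> real) measure) ({l $ 1<..<u $ 1} \<times> ({l $ 2<..<u $ 2} \<times> {l $ 3<..<u $ 3}))"
    using borel_measurable_vec3 by (simp add: emeasure_distr)
  also have "\<dots> = ennreal (u $ 1 - l $ 1) * (ennreal (u $ 2 - l $ 2) * ennreal (u $ 3 - l $ 3))"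
    by (simp add: emeasure_lborel_Times borel_Times le')
  also have "\<dots> = ennreal ((u $ 1 - l $ 1) * ((u $ 2 - l $ 2) * (u $ 3 - l $ 3)))"
    by (simp only: ennreal_mult[symmetric] mult_nonneg_nonneg diff_ge_0_iff_ge le')
  also have "(u $ 1 - l $ 1) * ((u $ 2 - l $ 2) * (u $ 3 - l $ 3)) = (\<Prod>b\<in>Basis. (u - l) \<bullet> b)"
  proof -
    have B: "(Basis :: (real ^ 3) set) = range (\<lambda>i. axis i 1)"
      unfolding Basis_vec_def by auto
    have "inj (\<lambda>i :: 3. axis i (1 :: real))"
      by (auto simp: inj_on_def axis_eq_axis)
    then have "(\<Prod>b\<in>Basis. (u - l) \<bullet> b) = (\<Prod>i\<in>UNIV. (u - l) $ i)"
      unfolding B using inner_axis[of "u - l"] by (simp only: prod.reindex) (simp add: inner_axis)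
    also have "\<dots> = (u $ 1 - l $ 1) * ((u $ 2 - l $ 2) * (u $ 3 - l $ 3))"
      by (simp only: UNIV_3) (simp add: mult.assoc)
    finally show ?thesis by (rule sym)
  qed
  finally show "emeasure (distr lborel borel (\<lambda>(a, b, c). vector [a, b, c])) (box l u)
     = ennreal (\<Prod>b\<in>Basis. (u - l) \<bullet> b)" .
qed simp

definition spherical_coords :: "real ^ 3 \<Rightarrow> real ^ 3" where
  "spherical_coords p = (p $ 1) *\<^sub>R sphere_point (p $ 2) (p $ 3)"

text \<open>Including \<open>\<phi> = 0\<close> keeps the coordinates injective and makes the \<open>\<phi>\<close>-range the one in the definition of
  the surface measure.\<close>

definition spherical_box :: "(real ^ 3) set" where
  "spherical_box = {p. 0 < p $ 1 \<and> p $ 1 < 1 \<and> 0 < p $ 2 \<and> p $ 2 < pi \<and> 0 \<le> p $ 3 \<and> p $ 3 < 2 * pi}"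

text \<open>The solid part of the unit ball over a subset of the sphere; its volume determines the area of that
  subset.\<close>

definition open_cone :: "(real ^ 3) set \<Rightarrow> (real ^ 3) set" where
  "open_cone A = {x. 0 < norm x \<and> norm x < 1 \<and> x /\<^sub>R norm x \<in> A}"

definition spherical_jacobian :: "real ^ 3 \<Rightarrow> real ^ 3 ^ 3" where
  "spherical_jacobian p = vector
     [vector [sin (p $ 2) * cos (p $ 3), p $ 1 * cos (p $ 2) * cos (p $ 3), - (p $ 1 * sin (p $ 2) * sin (p $ 3))],
      vector [sin (p $ 2) * sin (p $ 3), p $ 1 * cos (p $ 2) * sin (p $ 3), p $ 1 * sin (p $ 2) * cos (p $ 3)],
      vector [cos (p $ 2), - (p $ 1 * sin (p $ 2)), 0]]"

lemma norm_sphere_point [simp]: "norm (sphere_point \<theta> \<phi>) = 1"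
  using sphere_point_in_sphere[of \<theta> \<phi>] by simp

lemma has_derivative_spherical_coords:
  "(spherical_coords has_derivative (\<lambda>h. spherical_jacobian p *v h)) (at p within S)"
proof -
  have nth: "((\<lambda>x :: real ^ 3. x $ i) has_derivative (\<lambda>x. x $ i)) (at p within S)" for i
    by (rule bounded_linear_imp_has_derivative) (rule bounded_linear_vec_nth)
  have "((\<lambda>x. spherical_coords x $ i) has_derivative (\<lambda>h. (spherical_jacobian p *v h) $ i)) (at p within S)" for i
  proof -
    have "((\<lambda>x. spherical_coords x $ 1) has_derivative (\<lambda>h. (spherical_jacobian p *v h) $ 1)) (at p within S)"
      unfolding spherical_coords_def sphere_point_def spherical_jacobian_def matrix_vector_mult_def sum_3
      by (simp, (rule derivative_eq_intros nth refl)+, simp add: fun_eq_iff algebra_simps)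
    moreover have "((\<lambda>x. spherical_coords x $ 2) has_derivative (\<lambda>h. (spherical_jacobian p *v h) $ 2)) (at p within S)"
      unfolding spherical_coords_def sphere_point_def spherical_jacobian_def matrix_vector_mult_def sum_3
      by (simp, (rule derivative_eq_intros nth refl)+, simp add: fun_eq_iff algebra_simps)
    moreover have "((\<lambda>x. spherical_coords x $ 3) has_derivative (\<lambda>h. (spherical_jacobian p *v h) $ 3)) (at p within S)"
      unfolding spherical_coords_def sphere_point_def spherical_jacobian_def matrix_vector_mult_def sum_3
      by (simp, (rule derivative_eq_intros nth refl)+, simp add: fun_eq_iff algebra_simps)
    ultimately show ?thesis using exhaust_3[of i] by auto
  qed
  then show ?thesis
    by (subst has_derivative_componentwise_within) (auto simp: Basis_vec_def inner_axis)
qed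

lemma det_spherical_jacobian: "det (spherical_jacobian p) = (p $ 1)\<^sup>2 * sin (p $ 2)"
proof -
  let ?r = "p $ 1" and ?c = "cos (p $ 2)" and ?s = "sin (p $ 2)" and ?c' = "cos (p $ 3)" and ?s' = "sin (p $ 3)"
  have "?c * ?c + ?s * ?s = 1" "?c' * ?c' + ?s' * ?s' = 1"
    by (simp_all flip: power2_eq_square)
  then show ?thesis
    unfolding det_3 spherical_jacobian_def power2_eq_square by (simp, algebra)
qed

lemma inj_on_spherical_coords: "inj_on spherical_coords spherical_box"
proof (rule inj_onI)
  fix p q assume p: "p \<in> spherical_box" and q: "q \<in> spherical_box"
    and eq: "spherical_coords p = spherical_coords q"
  have "norm (spherical_coords p) = norm (spherical_coords q)" using eq by simp
  then have 1: "p $ 1 = q $ 1"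
    using p q by (simp add: spherical_coords_def spherical_box_def)
  with eq have eq': "sphere_point (p $ 2) (p $ 3) = sphere_point (q $ 2) (q $ 3)"
    using q by (simp add: spherical_coords_def spherical_box_def)
  from this[THEN arg_cong, of "\<lambda>v. v $ 3"] have "cos (p $ 2) = cos (q $ 2)"
    by (simp add: sphere_point_def)
  then have 2: "p $ 2 = q $ 2"
    using p q by - (rule cos_inj_pi, auto simp: spherical_box_def)
  have "sin (q $ 2) > 0" using q by (intro sin_gt_zero) (auto simp: spherical_box_def)
  with eq' 2 have "sin (p $ 3) = sin (q $ 3) \<and> cos (p $ 3) = cos (q $ 3)"
    by (auto simp: sphere_point_def vec_eq_iff forall_3)
  then obtain n :: int where n: "p $ 3 = q $ 3 + 2 * pi * n"
    by (auto simp: sin_cos_eq_iff)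
  have "\<bar>2 * pi * n\<bar> < 2 * pi * 1"
    using p q n by (auto simp: spherical_box_def)
  then have "n = 0"
    by (simp add: abs_mult)
  with n 1 2 show "p = q" by (simp add: vec_eq_iff forall_3)
qed

text \<open>The coordinates cover the cone except for the third axis; a coordinate plane containing that axis is
  enough to see that the exception is negligible.\<close>

lemma spherical_coords_image:
  defines "B A \<equiv> {p \<in> spherical_box. sphere_point (p $ 2) (p $ 3) \<in> A}"
  shows "spherical_coords ` B A \<subseteq> open_cone A"
    and "open_cone A - spherical_coords ` B A \<subseteq> {x. x $ 2 = 0}"
proof -
  have "sphere_point \<theta> \<phi> \<noteq> 0" for \<theta> \<phi>
    by (metis norm_sphere_point norm_zero zero_neq_one)
  then show "spherical_coords ` B A \<subseteq> open_cone A"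
    by (auto simp: B_def open_cone_def spherical_coords_def spherical_box_def)
  show "open_cone A - spherical_coords ` B A \<subseteq> {x. x $ 2 = 0}"
  proof (rule subsetI, rule ccontr)
    fix x assume x: "x \<in> open_cone A - spherical_coords ` B A" and "x \<notin> {x. x $ 2 = 0}"
    then have ne: "x $ 2 \<noteq> 0" and nx: "0 < norm x" "norm x < 1" by (auto simp: open_cone_def)
    define y where "y = x /\<^sub>R norm x"
    have y: "norm y = 1" "y \<in> A" and y2: "y $ 2 \<noteq> 0"
      using x nx ne by (auto simp: y_def open_cone_def)
    define \<theta> \<phi> where "\<theta> = arccos (y $ 3)" and "\<phi> = Arg2pi (Complex (y $ 1) (y $ 2))"
    have sp: "sphere_point \<theta> \<phi> = y"
      unfolding \<theta>_def \<phi>_def using y by (intro sphere_point_of_sphere) simp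
    have "sin \<theta> \<noteq> 0" using sp y2 by (auto simp: sphere_point_def vec_eq_iff forall_3)
    moreover have "0 \<le> \<theta>" "\<theta> \<le> pi"
      using component_le_norm_cart[of y 3] y by (auto simp: \<theta>_def intro!: arccos_lbound arccos_ubound)
    ultimately have "0 < \<theta>" "\<theta> < pi" by (auto simp: less_le)
    moreover have "0 \<le> \<phi>" "\<phi> < 2 * pi" by (auto simp: \<phi>_def Arg2pi_ge_0 Arg2pi_lt_2pi)
    ultimately have "vector [norm x, \<theta>, \<phi>] \<in> B A"
      using nx sp y by (simp add: B_def spherical_box_def)
    moreover have "spherical_coords (vector [norm x, \<theta>, \<phi>]) = x"
      using nx by (simp add: spherical_coords_def sp) (simp add: y_def)
    ultimately show False using x by (metis DiffD2 image_eqI)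
  qed
qed

section \<open>Rotation invariance of the surface measure and the distribution of an inner product\<close>

lemma borel_measurable_vec_component [measurable]:
  "(\<lambda>x :: real ^ 'n. x $ i) \<in> borel_measurable borel"
  by (intro borel_measurable_continuous_onI continuous_intros)

lemma sets_open_cone [measurable]:
  assumes [measurable]: "A \<in> sets borel"
  shows "open_cone A \<in> sets borel"
  unfolding open_cone_def by measurable

lemma bounded_open_cone: "bounded (open_cone A)"
  by (rule bounded_subset[of "ball 0 1"]) (auto simp: open_cone_def)

text \<open>Change of variables to spherical coordinates: the volume element is \<open>r\<^sup>2 sin \<theta>\<close>, and the radial integral
  is \<open>1 / 3\<close>.\<close>

lemma emeasure_open_cone:
  assumes A [measurable]: "A \<in> sets borel"
  shows "emeasure lborel (open_cone A) = ennreal (1 / 3) * emeasure borel_sphere_measure A"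
proof -
  define B where "B = {p \<in> spherical_box. sphere_point (p $ 2) (p $ 3) \<in> A}"
  define f where "f = (\<lambda>p :: real ^ 3. \<bar>det (matrix (\<lambda>h. spherical_jacobian p *v h))\<bar>)"
  have f: "f p = (p $ 1)\<^sup>2 * \<bar>sin (p $ 2)\<bar>" for p
    by (simp add: f_def det_spherical_jacobian abs_mult)
  have [measurable]: "(\<lambda>p :: real ^ 3. sphere_point (p $ 2) (p $ 3)) \<in> borel_measurable borel"
    using measurable_compose[OF borel_measurable_Pair[OF borel_measurable_vec_component borel_measurable_vec_component] borel_measurable_sphere_point, of 2 3]
    by simp
  have G: "(\<lambda>q. indicator ({0..pi} \<times> {0..<2 * pi}) q * ennreal (sin (fst q)) * indicator A (sphere_point (fst q) (snd q)) :: ennreal)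
      \<in> borel_measurable borel"
  proof -
    have [measurable]: "(\<lambda>q. sphere_point (fst q) (snd q)) \<in> borel_measurable (borel \<Otimes>\<^sub>M borel)"
      using borel_measurable_sphere_point by (simp add: case_prod_beta' borel_prod)
    show ?thesis unfolding borel_prod[symmetric] by measurable
  qed
  have [measurable]: "spherical_box \<in> sets borel"
    unfolding spherical_box_def by measurable
  have [measurable]: "B \<in> sets borel"
    unfolding B_def by measurable
  have [measurable]: "f \<in> borel_measurable borel"
    unfolding f by measurable
  have "bounded B"
    by (rule bounded_subset[of "cbox 0 (vector [1, pi, 2 * pi])"])
      (auto simp: B_def spherical_box_def mem_box_cart forall_3)
  then have "emeasure lborel B < \<infinity>"
    by (rule emeasure_bounded_finite)
  moreover have "norm (f p) \<le> 1" if "p \<in> B" for p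
  proof -
    have "(p $ 1)\<^sup>2 \<le> 1" using that by (auto simp: B_def spherical_box_def power_le_one)
    then show ?thesis by (auto simp: f intro!: mult_le_one)
  qed
  ultimately have int: "set_integrable lborel B f"
    unfolding set_integrable_def by (intro integrableI_bounded_set_indicator[where B = 1]) auto
  have der: "(spherical_coords has_derivative (\<lambda>h. spherical_jacobian p *v h)) (at p within B)" for p
    by (rule has_derivative_spherical_coords)
  have inj: "inj_on spherical_coords B"
    using inj_on_spherical_coords by (rule inj_on_subset) (auto simp: B_def)
  have B_leb: "B \<in> sets lebesgue" by simp
  have int': "(\<lambda>p. \<bar>det (matrix (\<lambda>h. spherical_jacobian p *v h))\<bar>) integrable_on B"
    using set_borel_integral_eq_integral(1)[OF int] by (simp add: f_def)
  have lm: "spherical_coords ` B \<in> lmeasurable"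
    using measurable_differentiable_image_eq[OF B_leb der inj] int' by blast
  have "open_cone A - spherical_coords ` B \<in> null_sets lebesgue"
    using spherical_coords_image(2)[of A] negligible_subset[OF negligible_standard_hyperplane_cart[of "2 :: 3"]]
    by (simp add: B_def negligible_iff_null_sets)
  then have "emeasure lebesgue (spherical_coords ` B \<union> (open_cone A - spherical_coords ` B))
     = emeasure lebesgue (spherical_coords ` B)"
    using lm by (intro emeasure_Un_null_set) auto
  also have "spherical_coords ` B \<union> (open_cone A - spherical_coords ` B) = open_cone A"
    using spherical_coords_image(1)[of A] by (auto simp: B_def)
  finally have "emeasure lborel (open_cone A) = emeasure lebesgue (spherical_coords ` B)"
    by simp
  also have "\<dots> = ennreal (measure lebesgue (spherical_coords ` B))"
    using lm by (simp add: emeasure_eq_measure2)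
  also have "measure lebesgue (spherical_coords ` B) = integral B f"
    using measure_differentiable_image_eq[OF B_leb der inj int'] by (simp add: f_def)
  also have "\<dots> = (LINT p:B|lborel. f p)"
    using set_borel_integral_eq_integral(2)[OF int] by simp
  also have "ennreal \<dots> = (\<integral>\<^sup>+p. ennreal (indicator B p *\<^sub>R f p) \<partial>lborel)"
    using int unfolding set_lebesgue_integral_def set_integrable_def
    by (intro nn_integral_eq_integral[symmetric]) (auto simp: f)
  also have "\<dots> = (\<integral>\<^sup>+p. ennreal (indicator B (case p of (a, b, c) \<Rightarrow> vector [a, b, c]) *\<^sub>R
       f (case p of (a, b, c) \<Rightarrow> vector [a, b, c])) \<partial>lborel)"
    by (subst lborel_vec3) (simp add: nn_integral_distr borel_measurable_vec3)
  also have "\<dots> = (\<integral>\<^sup>+(r, q). (ennreal (r\<^sup>2) * indicator {0<..<1} r) *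
      (indicator ({0..pi} \<times> {0..<2 * pi}) q * ennreal (sin (fst q)) * indicator A (sphere_point (fst q) (snd q))) \<partial>lborel)"
  proof (intro nn_integral_cong)
    fix p :: "real \<times> real \<times> real"
    obtain a b c where p: "p = (a, b, c)" by (rule prod_cases3)
    show "ennreal (indicator B (case p of (a, b, c) \<Rightarrow> vector [a, b, c]) *\<^sub>R
        f (case p of (a, b, c) \<Rightarrow> vector [a, b, c]))
      = (case p of (r, q) \<Rightarrow> (ennreal (r\<^sup>2) * indicator {0<..<1} r) * (indicator ({0..pi} \<times> {0..<2 * pi}) q
        * ennreal (sin (fst q)) * indicator A (sphere_point (fst q) (snd q))))"
    proof (cases "0 < a \<and> a < 1 \<and> 0 \<le> b \<and> b \<le> pi \<and> 0 \<le> c \<and> c < 2 * pi \<and> sphere_point b c \<in> A")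
      case True
      then have "0 \<le> sin b" by (auto intro: sin_ge_zero)
      \<comment> \<open>\<open>spherical_box\<close> excludes the poles, where \<open>sin\<close> vanishes anyway\<close>
      moreover have "b = 0 \<or> b = pi \<or> (0 < b \<and> b < pi)" using True by auto
      ultimately show ?thesis
        using True by (auto simp: p B_def spherical_box_def f ennreal_mult indicator_def)
    next
      case False
      then show ?thesis
        by (auto simp: p B_def spherical_box_def indicator_def)
    qed
  qed
  also have "\<dots> = (\<integral>\<^sup>+r. (\<integral>\<^sup>+q. (ennreal (r\<^sup>2) * indicator {0<..<1} r) *
      (indicator ({0..pi} \<times> {0..<2 * pi}) q * ennreal (sin (fst q)) * indicator A (sphere_point (fst q) (snd q))) \<partial>lborel) \<partial>lborel)"
  proof -
    have [measurable]: "(\<lambda>q. indicator ({0..pi} \<times> {0..<2 * pi}) q * ennreal (sin (fst q)) * indicator A (sphere_point (fst q) (snd q)) :: ennreal)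
      \<in> borel_measurable borel" by (rule G)
    have "(\<lambda>(r, q). (ennreal (r\<^sup>2) * indicator {0<..<1} r) * (indicator ({0..pi} \<times> {0..<2 * pi}) q
        * ennreal (sin (fst q)) * indicator A (sphere_point (fst q) (snd q)))) \<in> borel_measurable (lborel \<Otimes>\<^sub>M lborel)"
      by measurable
    from lborel.nn_integral_fst[OF this] show ?thesis by (simp add: lborel_prod)
  qed
  also have "\<dots> = (\<integral>\<^sup>+r. (ennreal (r\<^sup>2) * indicator {0<..<1} r) * emeasure borel_sphere_measure A \<partial>lborel)"
    using G by (intro nn_integral_cong) (simp add: emeasure_borel_sphere_measure[OF A] nn_integral_cmult)
  also have "\<dots> = (\<integral>\<^sup>+r. ennreal (r\<^sup>2) * indicator {0<..<1} r \<partial>lborel) * emeasure borel_sphere_measure A"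
    by (rule nn_integral_multc) measurable
  also have "(\<integral>\<^sup>+r. ennreal (r\<^sup>2) * indicator {0<..<1} r \<partial>lborel) = ennreal (1 / 3)"
  proof -
    have "(\<integral>\<^sup>+r. ennreal (r\<^sup>2) * indicator {0<..<1} r \<partial>lborel) = (\<integral>\<^sup>+r. ennreal (r\<^sup>2) * indicator {0..1} r \<partial>lborel)"
    proof (rule nn_integral_cong_AE)
      show "AE r in lborel. ennreal (r\<^sup>2) * indicator {0<..<1} r = ennreal (r\<^sup>2) * indicator {0..1} r"
        using AE_lborel_singleton[of "1 :: real"] by eventually_elim (auto simp: indicator_def)
    qed
    also have "\<dots> = ennreal (1 ^ 3 / 3 - 0 ^ 3 / 3)"
      by (rule nn_integral_FTC_Icc) (auto intro!: derivative_eq_intros simp: power2_eq_square)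
    finally show ?thesis by simp
  qed
  finally show ?thesis .
qed

lemma borel_measurable_orthogonal_transformation:
  fixes f :: "'a :: euclidean_space \<Rightarrow> 'a"
  assumes "orthogonal_transformation f"
  shows "f \<in> borel_measurable borel"
  using assms by (intro borel_measurable_continuous_onI linear_continuous_on)
    (simp add: linear_linear orthogonal_transformation_linear)

text \<open>Orthogonal maps preserve volume and map cones to cones, so by \<open>emeasure_open_cone\<close> they preserve
  surface area.\<close>

lemma distr_orthogonal_borel_sphere_measure:
  assumes f: "orthogonal_transformation f"
  shows "distr borel_sphere_measure borel f = borel_sphere_measure"
proof (rule measure_eqI)
  have [measurable]: "f \<in> borel_measurable borel"
    using f by (rule borel_measurable_orthogonal_transformation)
  fix A assume "A \<in> sets (distr borel_sphere_measure borel f)"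
  then have [measurable]: "A \<in> sets borel" by simp
  have [measurable]: "f -` A \<in> sets borel"
    using measurable_sets_borel[of f borel A] by simp
  have "f ` open_cone (f -` A) = open_cone A"
  proof -
    have "f (x /\<^sub>R norm x) = f x /\<^sub>R norm (f x)" for x
      using f by (simp add: orthogonal_transformation_norm orthogonal_transformation_scaleR)
    then have "x \<in> open_cone (f -` A) \<longleftrightarrow> f x \<in> open_cone A" for x
      using f by (simp add: open_cone_def orthogonal_transformation_norm del: zero_less_norm_iff)
    then have "open_cone (f -` A) = f -` open_cone A" by blast
    then show ?thesis
      using orthogonal_transformation_surj[OF f] by (simp add: surj_image_vimage_eq)
  qed
  moreover have lm: "open_cone (f -` A) \<in> lmeasurable" "open_cone A \<in> lmeasurable"
    by (auto intro!: bounded_set_imp_lmeasurable bounded_open_cone)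
  ultimately have "measure lebesgue (open_cone A) = measure lebesgue (open_cone (f -` A))"
    using measure_orthogonal_image[OF f lm(1)] by simp
  then have "emeasure lebesgue (open_cone A) = emeasure lebesgue (open_cone (f -` A))"
    using lm by (simp only: emeasure_eq_measure2)
  then have "emeasure lborel (open_cone A) = emeasure lborel (open_cone (f -` A))"
    by simp
  then have "emeasure borel_sphere_measure (f -` A) = emeasure borel_sphere_measure A"
    by (simp add: emeasure_open_cone ennreal_mult_cancel_left)
  then show "emeasure (distr borel_sphere_measure borel f) A = emeasure borel_sphere_measure A"
    by (simp add: emeasure_distr)
qed simp

text \<open>Archimedes: the area of a zone is proportional to its height. By invariance \<open>x\<close> can be assumed to be
  the south pole, where \<open>x \<bullet> y = - cos \<theta>\<close> is increasing in \<open>\<theta>\<close>, as the substitution rule for the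
  integral requires.\<close>

lemma distr_inner_borel_sphere_measure:
  fixes x :: "real ^ 3"
  assumes "norm x = 1"
  shows "distr borel_sphere_measure borel (\<lambda>y. x \<bullet> y) = density lborel (\<lambda>t. ennreal (2 * pi) * indicator {-1..1} t)"
proof (rule measure_eqI)
  have "norm (- axis (3 :: 3) (1 :: real)) = norm x" using assms by simp
  from orthogonal_transformation_exists[OF this]
  obtain f :: "real ^ 3 \<Rightarrow> real ^ 3" where f: "orthogonal_transformation f" and fx: "f (- axis 3 1) = x"
    by metis
  have [measurable]: "f \<in> borel_measurable borel"
    using f by (rule borel_measurable_orthogonal_transformation)
  have xf: "x \<bullet> f y = - (y $ 3)" for y
    using f unfolding fx[symmetric] by (simp add: orthogonal_transformation_def inner_axis')
  fix A assume "A \<in> sets (distr borel_sphere_measure borel (\<lambda>y. x \<bullet> y))"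
  then have A [measurable]: "A \<in> sets borel" by simp
  have "distr borel_sphere_measure borel (\<lambda>y. x \<bullet> y)
    = distr (distr borel_sphere_measure borel f) borel (\<lambda>y. x \<bullet> y)"
    by (simp add: distr_orthogonal_borel_sphere_measure f)
  also have "\<dots> = distr borel_sphere_measure borel (\<lambda>y. - (y $ 3))"
    by (subst distr_distr) (simp_all add: o_def xf)
  finally have "emeasure (distr borel_sphere_measure borel (\<lambda>y. x \<bullet> y)) A
     = emeasure borel_sphere_measure ((\<lambda>y. - (y $ 3)) -` A)"
    by (simp add: emeasure_distr)
  also have "\<dots> = (\<integral>\<^sup>+p. indicator ({0..pi} \<times> {0..<2 * pi}) p * ennreal (sin (fst p)) * indicator A (- cos (fst p)) \<partial>lborel)"
  proof -
    have "(\<lambda>y :: real ^ 3. - (y $ 3)) -` A \<in> sets borel"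
      using measurable_sets_borel[of "\<lambda>y :: real ^ 3. - (y $ 3)" borel A] by simp
    then show ?thesis
      by (subst emeasure_borel_sphere_measure) (auto simp: sphere_point_def indicator_def intro!: nn_integral_cong)
  qed
  also have "\<dots> = (\<integral>\<^sup>+(\<theta>, \<phi>). (ennreal (sin \<theta>) * indicator {0..pi} \<theta> * indicator A (- cos \<theta>)) * indicator {0..<2 * pi} \<phi> \<partial>(lborel \<Otimes>\<^sub>M lborel))"
    unfolding lborel_prod by (auto simp: indicator_def intro!: nn_integral_cong)
  also have "\<dots> = (\<integral>\<^sup>+\<theta>. (\<integral>\<^sup>+\<phi>. (ennreal (sin \<theta>) * indicator {0..pi} \<theta> * indicator A (- cos \<theta>)) * indicator {0..<2 * pi} \<phi> \<partial>lborel) \<partial>lborel)"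
    by (subst lborel.nn_integral_fst[symmetric]) auto
  also have "\<dots> = (\<integral>\<^sup>+\<theta>. ennreal (2 * pi) * (ennreal (sin \<theta>) * indicator {0..pi} \<theta> * indicator A (- cos \<theta>)) \<partial>lborel)"
    by (intro nn_integral_cong) (subst nn_integral_cmult_indicator, auto simp: mult.commute)
  also have "\<dots> = ennreal (2 * pi) * (\<integral>\<^sup>+\<theta>. ennreal (sin \<theta>) * indicator {0..pi} \<theta> * indicator A (- cos \<theta>) \<partial>lborel)"
    by (rule nn_integral_cmult) measurable
  also have "(\<integral>\<^sup>+\<theta>. ennreal (sin \<theta>) * indicator {0..pi} \<theta> * indicator A (- cos \<theta>) \<partial>lborel)
      = (\<integral>\<^sup>+t. ennreal (indicator A t * indicator {-1..1} t) \<partial>lborel)"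
  proof -
    have "(\<integral>\<^sup>+t. ennreal (indicator A t * indicator {- cos 0..- cos pi} t) \<partial>lborel)
      = (\<integral>\<^sup>+\<theta>. ennreal (indicator A (- cos \<theta>) * sin \<theta> * indicator {0..pi} \<theta>) \<partial>lborel)"
      by (rule nn_integral_substitution)
        (auto simp: set_borel_measurable_def sin_ge_zero intro!: derivative_eq_intros continuous_intros)
    also have "\<dots> = (\<integral>\<^sup>+\<theta>. ennreal (sin \<theta>) * indicator {0..pi} \<theta> * indicator A (- cos \<theta>) \<partial>lborel)"
      by (auto simp: indicator_def intro!: nn_integral_cong)
    finally show ?thesis by simp
  qed
  also have "ennreal (2 * pi) * (\<integral>\<^sup>+t. ennreal (indicator A t * indicator {-1..1} t) \<partial>lborel)
      = (\<integral>\<^sup>+t. ennreal (2 * pi) * ennreal (indicator A t * indicator {-1..1} t) \<partial>lborel)"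
    by (rule nn_integral_cmult[symmetric]) measurable
  also have "\<dots> = emeasure (density lborel (\<lambda>t. ennreal (2 * pi) * indicator {-1..1} t)) A"
    by (subst emeasure_density) (auto simp: indicator_def intro!: nn_integral_cong)
  finally show "emeasure (distr borel_sphere_measure borel (\<lambda>y. x \<bullet> y)) A
     = emeasure (density lborel (\<lambda>t. ennreal (2 * pi) * indicator {-1..1} t)) A" .
qed simp

section \<open>The Funk--Hecke formula\<close>

lemma AE_norm_borel_sphere_measure: "AE y in borel_sphere_measure. norm y = 1"
  unfolding borel_sphere_measure_def by (subst AE_distr_iff) (auto simp: split_beta)

lemma borel_measurable_null_functional [measurable]:
  "null_functional a b \<in> borel_measurable borel"
proof -
  have "null_functional a b = (\<lambda>y. of_real (a \<bullet> y) + \<i> * of_real (b \<bullet> y))"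
    by (auto simp: null_functional_def complex_eq_iff)
  then show ?thesis by simp
qed

lemma norm_null_functional_le:
  assumes "norm y = 1"
  shows "norm (null_functional a b y) \<le> norm a + norm b"
proof -
  have "norm (null_functional a b y) \<le> \<bar>a \<bullet> y\<bar> + \<bar>b \<bullet> y\<bar>"
    using cmod_le[of "null_functional a b y"] by (simp add: null_functional_def)
  also have "\<dots> \<le> norm a + norm b"
    using Cauchy_Schwarz_ineq2[of a y] Cauchy_Schwarz_ineq2[of b y] assms by simp
  finally show ?thesis .
qed

lemma integral_borel_sphere_measure_rotate:
  fixes F :: "real ^ 3 \<Rightarrow> complex"
  assumes f: "orthogonal_transformation f" and F: "F \<in> borel_measurable borel"
  shows "(\<integral>y. F (f y) \<partial>borel_sphere_measure) = (\<integral>y. F y \<partial>borel_sphere_measure)"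
    and "integrable borel_sphere_measure (\<lambda>y. F (f y)) \<longleftrightarrow> integrable borel_sphere_measure F"
  using F borel_measurable_orthogonal_transformation[OF f]
    integral_distr[of f borel_sphere_measure borel F] integrable_distr_eq[of f borel_sphere_measure borel F]
  by (simp_all add: distr_orthogonal_borel_sphere_measure[OF f])

lemma integral_zonal:
  fixes k :: "real \<Rightarrow> real" and x :: "real ^ 3"
  assumes k: "integrable lborel (\<lambda>t. indicator {-1..1} t * k t)" and [measurable]: "k \<in> borel_measurable borel"
    and x: "norm x = 1"
  shows "integrable borel_sphere_measure (\<lambda>y. k (x \<bullet> y))"
    and "(\<integral>y. k (x \<bullet> y) \<partial>borel_sphere_measure) = 2 * pi * (\<integral>t. indicator {-1..1} t * k t \<partial>lborel)"
proof -
  have d: "density lborel (\<lambda>t. ennreal (2 * pi) * indicator {-1..1} t) = density lborel (\<lambda>t. ennreal (2 * pi * indicator {-1..1} t))"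
    by (rule arg_cong[where f = "density lborel"]) (auto simp: indicator_def)
  have m [measurable]: "(\<lambda>y. x \<bullet> y) \<in> borel_measurable borel_sphere_measure" by simp
  show "integrable borel_sphere_measure (\<lambda>y. k (x \<bullet> y))"
    unfolding integrable_distr_eq[OF m \<open>k \<in> _\<close>, symmetric] distr_inner_borel_sphere_measure[OF x] d
    by (subst integrable_density) (use k in \<open>auto simp: mult.assoc\<close>)
  show "(\<integral>y. k (x \<bullet> y) \<partial>borel_sphere_measure) = 2 * pi * (\<integral>t. indicator {-1..1} t * k t \<partial>lborel)"
    unfolding integral_distr[OF m \<open>k \<in> _\<close>, symmetric] distr_inner_borel_sphere_measure[OF x] d
    by (subst integral_density) (auto simp: mult.assoc)
qed

lemma borel_measurable_poly [measurable]: "poly (p :: real poly) \<in> borel_measurable borel"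
  by (intro borel_measurable_continuous_onI continuous_intros)

lemma set_integrable_mult_poly:
  fixes k :: "real \<Rightarrow> real"
  assumes k: "set_integrable M {-1..1} k" and p: "poly p \<in> borel_measurable M"
  shows "set_integrable M {-1..1} (\<lambda>t. k t * poly p t)"
proof -
  have "continuous_on {-1..1} (poly p)" by (intro continuous_intros)
  then have "bounded (poly p ` {-1..1})"
    by (intro compact_imp_bounded compact_continuous_image) auto
  then obtain C where C: "\<forall>t\<in>{-1..1}. \<bar>poly p t\<bar> \<le> C"
    unfolding bounded_iff by auto
  have "integrable M (\<lambda>t. C * (indicator {-1..1} t *\<^sub>R k t))"
    using k by (simp add: set_integrable_def)
  then show ?thesis
    unfolding set_integrable_def
  proof (rule Bochner_Integration.integrable_bound)
    have "(\<lambda>t. indicator {-1..1} t *\<^sub>R k t) \<in> borel_measurable M"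
      using k by (auto simp: set_integrable_def)
    from borel_measurable_times[OF this p]
    show "(\<lambda>t. indicator {-1..1} t *\<^sub>R (k t * poly p t)) \<in> borel_measurable M"
      by (simp add: mult.assoc)
    show "AE t in M. norm (indicator {-1..1} t *\<^sub>R (k t * poly p t)) \<le> norm (C * (indicator {-1..1} t *\<^sub>R k t))"
    proof (rule AE_I2)
      fix t :: real
      show "norm (indicator {-1..1} t *\<^sub>R (k t * poly p t)) \<le> norm (C * (indicator {-1..1} t *\<^sub>R k t))"
      proof (cases "t \<in> {-1..1}")
        case True
        then have "\<bar>poly p t\<bar> \<le> \<bar>C\<bar>" using C by fastforce
        then show ?thesis
          using True by (simp add: abs_mult mult.commute[of "\<bar>C\<bar>"] mult_left_mono)
      qed simp
    qed
  qed
qed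

text \<open>After a rotation taking the third axis to \<open>x\<close>, the integral does not change when the null functional
  is composed with a rotation about that axis, because \<open>x \<bullet> y\<close> does not see it. Summing over \<open>N\<close> such
  rotations replaces the power of the functional by its mean over circles of latitude.\<close>

lemma funk_hecke_null_power:
  fixes k :: "real \<Rightarrow> real" and x :: "real ^ 3"
  assumes k: "integrable lborel (\<lambda>t. indicator {-1..1} t * k t)" and [measurable]: "k \<in> borel_measurable borel"
    and x: "norm x = 1" and ab: "null_pair a b"
  shows "integrable borel_sphere_measure (\<lambda>y. of_real (k (x \<bullet> y)) * null_functional a b y ^ l)"
    and "(\<integral>y. of_real (k (x \<bullet> y)) * null_functional a b y ^ l \<partial>borel_sphere_measure)
      = 2 * pi * of_real (\<integral>t. indicator {-1..1} t * (k t * poly (legendre_poly l) t) \<partial>lborel) * null_functional a b x ^ l"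
proof -
  let ?L = "null_functional a b"
  have int: "integrable borel_sphere_measure (\<lambda>y. of_real (k (z \<bullet> y)) * null_functional a b y ^ l)"
    if "norm z = 1" for z a b
  proof -
    have "integrable borel_sphere_measure (\<lambda>y. (norm a + norm b) ^ l * k (z \<bullet> y))"
      using integral_zonal(1)[OF k _ that] by simp
    then show ?thesis
    proof (rule Bochner_Integration.integrable_bound)
      show "AE y in borel_sphere_measure. norm (of_real (k (z \<bullet> y)) * null_functional a b y ^ l)
          \<le> norm ((norm a + norm b) ^ l * k (z \<bullet> y))"
        using AE_norm_borel_sphere_measure
      proof eventually_elim
        case (elim y)
        then show ?case
          using power_mono[OF norm_null_functional_le[OF elim, of a b], of l]
          by (simp add: norm_mult norm_power abs_mult mult.commute mult_left_mono)
      qed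
    qed measurable
  qed
  show "integrable borel_sphere_measure (\<lambda>y. of_real (k (x \<bullet> y)) * ?L y ^ l)"
    by (rule int[OF x])
  have "norm (axis (3 :: 3) (1 :: real)) = norm x" using x by simp
  from orthogonal_transformation_exists[OF this]
  obtain f :: "real ^ 3 \<Rightarrow> real ^ 3" where f: "orthogonal_transformation f" and fx: "f (axis 3 1) = x"
    by metis
  let ?L' = "null_functional (inv f a) (inv f b)"
  have ab': "null_pair (inv f a) (inv f b)" using f ab by (rule null_pair_orthogonal)
  have xf: "x \<bullet> f y = y $ 3" for y
    using f unfolding fx[symmetric] by (simp add: orthogonal_transformation_def inner_axis')
  define N where "N = 2 * l + 1"
  define I where "I = (\<integral>y. of_real (k (x \<bullet> y)) * ?L y ^ l \<partial>borel_sphere_measure)"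
  have "I = (\<integral>y. of_real (k (x \<bullet> f y)) * ?L (f y) ^ l \<partial>borel_sphere_measure)"
    unfolding I_def by (rule integral_borel_sphere_measure_rotate(1)[OF f, symmetric]) measurable
  then have I: "I = (\<integral>y. of_real (k (y $ 3)) * ?L' y ^ l \<partial>borel_sphere_measure)"
    by (simp add: xf null_functional_orthogonal[OF f])
  have rot: "(\<integral>y. of_real (k (y $ 3)) * ?L' (axis_rotation \<psi> y) ^ l \<partial>borel_sphere_measure) = I"
    and int_rot: "integrable borel_sphere_measure (\<lambda>y. of_real (k (y $ 3)) * ?L' (axis_rotation \<psi> y) ^ l)" for \<psi>
    using integral_borel_sphere_measure_rotate[OF orthogonal_transformation_axis_rotation[of \<psi>],
        of "\<lambda>y. of_real (k (y $ 3)) * ?L' y ^ l"] int[of "axis 3 1" "inv f a" "inv f b"]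
    by (simp_all add: I inner_axis') (simp_all add: axis_rotation_def)
  have "of_nat N * I = (\<Sum>j<N. \<integral>y. of_real (k (y $ 3)) * ?L' (axis_rotation (node N j) y) ^ l \<partial>borel_sphere_measure)"
    by (simp add: rot)
  also have "\<dots> = (\<integral>y. (\<Sum>j<N. of_real (k (y $ 3)) * ?L' (axis_rotation (node N j) y) ^ l) \<partial>borel_sphere_measure)"
    by (rule Bochner_Integration.integral_sum[symmetric]) (rule int_rot)
  also have "\<dots> = (\<integral>y. of_nat N * ?L x ^ l * of_real (k (axis 3 1 \<bullet> y) * poly (legendre_poly l) (axis 3 1 \<bullet> y)) \<partial>borel_sphere_measure)"
  proof (rule integral_cong_AE)
    show "AE y in borel_sphere_measure. (\<Sum>j<N. of_real (k (y $ 3)) * ?L' (axis_rotation (node N j) y) ^ l)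
       = of_nat N * ?L x ^ l * of_real (k (axis 3 1 \<bullet> y) * poly (legendre_poly l) (axis 3 1 \<bullet> y))"
      using AE_norm_borel_sphere_measure
    proof eventually_elim
      case (elim y)
      have "?L' (axis 3 1) = ?L x" using null_functional_orthogonal[OF f, of a b "axis 3 1"] by (simp add: fx)
      then show ?case
        using mean_rotated_null_power_axis[OF ab' elim, of l N]
        by (simp add: N_def inner_axis' flip: sum_distrib_left)
    qed
    have [measurable]: "axis_rotation \<psi> \<in> borel_measurable borel" for \<psi>
      by (rule borel_measurable_orthogonal_transformation[OF orthogonal_transformation_axis_rotation])
    show "(\<lambda>y. \<Sum>j<N. of_real (k (y $ 3)) * ?L' (axis_rotation (node N j) y) ^ l) \<in> borel_measurable borel_sphere_measure"
      by measurable
    show "(\<lambda>y. of_nat N * ?L x ^ l * of_real (k (axis 3 1 \<bullet> y) * poly (legendre_poly l) (axis 3 1 \<bullet> y))) \<in> borel_measurable borel_sphere_measure"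
      by measurable
  qed
  also have "\<dots> = of_nat N * ?L x ^ l * of_real (\<integral>y. k (axis 3 1 \<bullet> y) * poly (legendre_poly l) (axis 3 1 \<bullet> y) \<partial>borel_sphere_measure)"
    by (simp only: integral_mult_right_zero integral_complex_of_real)
  also have "(\<integral>y. k (axis 3 1 \<bullet> y) * poly (legendre_poly l) (axis 3 1 \<bullet> y) \<partial>borel_sphere_measure)
     = 2 * pi * (\<integral>t. indicator {-1..1} t * (k t * poly (legendre_poly l) t) \<partial>lborel)"
    using integral_zonal(2)[of "\<lambda>t. k t * poly (legendre_poly l) t" "axis 3 1"]
      set_integrable_mult_poly[of lborel k "legendre_poly l"] k
    by (simp add: set_integrable_def)
  finally show "(\<integral>y. of_real (k (x \<bullet> y)) * ?L y ^ l \<partial>borel_sphere_measure)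
      = 2 * pi * of_real (\<integral>t. indicator {-1..1} t * (k t * poly (legendre_poly l) t) \<partial>lborel) * ?L x ^ l"
    unfolding I_def[symmetric] using of_nat_neq_0[of "2 * l", where 'a = complex]
    by (simp add: N_def mult_ac del: of_nat_Suc of_nat_add)
qed

text \<open>Unlike \<open>borel_sphere_measure\<close> this lives on the sphere alone; its completion is the surface measure.\<close>

definition chart_sphere_measure :: "(real ^ 3) measure" where
  "chart_sphere_measure = distr angle_measure (restrict_space borel (sphere 0 1)) (\<lambda>(\<theta>, \<phi>). sphere_point \<theta> \<phi>)"

lemma sphere_measure_eq_completion: "sphere_measure = completion chart_sphere_measure"
  by (simp add: sphere_measure_def chart_sphere_measure_def angle_measure_def)

lemma sets_chart_sphere_measure [measurable_cong]: "sets chart_sphere_measure = sets (restrict_space borel (sphere 0 1))"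
  and space_chart_sphere_measure: "space chart_sphere_measure = sphere 0 1"
  by (simp_all add: chart_sphere_measure_def space_restrict_space)

lemma measurable_id_chart_sphere_measure: "(\<lambda>y. y) \<in> chart_sphere_measure \<rightarrow>\<^sub>M borel"
  by (simp add: measurable_cong_sets[OF sets_chart_sphere_measure refl] measurable_restrict_space1)

lemma borel_sphere_measure_eq_distr: "borel_sphere_measure = distr chart_sphere_measure borel (\<lambda>y. y)"
proof -
  have "(\<lambda>(\<theta>, \<phi>). sphere_point \<theta> \<phi>) \<in> angle_measure \<rightarrow>\<^sub>M restrict_space borel (sphere 0 1)"
    using measurable_sphere_point by simp
  then show ?thesis
    unfolding borel_sphere_measure_def chart_sphere_measure_def
    by (subst distr_distr) (simp_all add: measurable_restrict_space1 o_def)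
qed

lemma AE_sphere_measure_I:
  assumes "AE y in borel_sphere_measure. P y"
  shows "AE y in sphere_measure. P y"
  using assms AE_distrD[OF measurable_id_chart_sphere_measure]
  unfolding borel_sphere_measure_eq_distr sphere_measure_eq_completion AE_completion_iff by blast

lemma sphere_measure_borel:
  fixes F :: "real ^ 3 \<Rightarrow> complex"
  assumes F: "F \<in> borel_measurable borel"
  shows "F \<in> borel_measurable sphere_measure"
    and "integrable sphere_measure F \<longleftrightarrow> integrable borel_sphere_measure F"
    and "integral\<^sup>L sphere_measure F = integral\<^sup>L borel_sphere_measure F"
proof -
  have m: "F \<in> borel_measurable chart_sphere_measure"
    using measurable_compose[OF measurable_id_chart_sphere_measure F] .
  show "F \<in> borel_measurable sphere_measure"
    unfolding sphere_measure_eq_completion using m by (rule measurable_completion)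
  show "integrable sphere_measure F \<longleftrightarrow> integrable borel_sphere_measure F"
    unfolding sphere_measure_eq_completion borel_sphere_measure_eq_distr integrable_completion[OF m]
    using integrable_distr_eq[OF measurable_id_chart_sphere_measure F] by simp
  show "integral\<^sup>L sphere_measure F = integral\<^sup>L borel_sphere_measure F"
    unfolding sphere_measure_eq_completion borel_sphere_measure_eq_distr integral_completion[OF m]
    using integral_distr[OF measurable_id_chart_sphere_measure F] by simp
qed

lemma AE_inner_sphere_measure:
  assumes x: "norm x = 1" and P: "AE t in lborel. P t"
  shows "AE y in borel_sphere_measure. P (x \<bullet> y)"
proof -
  have "AE t in distr borel_sphere_measure borel (\<lambda>y. x \<bullet> y). P t"
    unfolding distr_inner_borel_sphere_measure[OF x]
    using P by (subst AE_density) auto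
  then show ?thesis
    by (rule AE_distrD[rotated]) simp
qed

text \<open>Null sets of \<open>[-1, 1]\<close> pull back to null sets of the sphere, so composing with \<open>y \<mapsto> x \<bullet> y\<close> preserves
  Lebesgue measurability and not only Borel measurability.\<close>

lemma measurable_inner_sphere_measure:
  assumes x: "norm x = 1"
  shows "(\<lambda>y. x \<bullet> y) \<in> sphere_measure \<rightarrow>\<^sub>M lebesgue"
proof -
  have m: "(\<lambda>y. x \<bullet> y) \<in> sphere_measure \<rightarrow>\<^sub>M lborel"
    unfolding sphere_measure_eq_completion
    using measurable_completion[OF measurable_compose[OF measurable_id_chart_sphere_measure, of "\<lambda>y. x \<bullet> y" borel]]
    by simp
  have "null_sets lborel \<subseteq> null_sets (distr sphere_measure lborel (\<lambda>y. x \<bullet> y))"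
  proof
    fix N :: "real set" assume N: "N \<in> null_sets lborel"
    then have "AE y in sphere_measure. x \<bullet> y \<notin> N"
      by (intro AE_sphere_measure_I AE_inner_sphere_measure[OF x] AE_not_in)
    then have "AE t in distr sphere_measure lborel (\<lambda>y. x \<bullet> y). t \<notin> N"
      using N m by (subst AE_distr_iff) auto
    then show "N \<in> null_sets (distr sphere_measure lborel (\<lambda>y. x \<bullet> y))"
      using N by (subst (asm) AE_iff_null_sets[symmetric]) auto
  qed
  then show ?thesis
    using completion.measurable_completion2[of "\<lambda>y. x \<bullet> y" chart_sphere_measure lborel] m
    by (simp add: sphere_measure_eq_completion)
qed

text \<open>A Lebesgue measurable profile agrees almost everywhere with a Borel one, and by absolute continuity of
  the distribution of \<open>x \<bullet> y\<close> the two give the same integrals on the sphere.\<close>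

lemma funk_hecke_null_power_lebesgue:
  fixes k :: "real \<Rightarrow> real" and x :: "real ^ 3"
  assumes k: "set_integrable lebesgue {-1..1} k" and x: "norm x = 1" and ab: "null_pair a b"
  shows "integrable sphere_measure (\<lambda>y. of_real (k (x \<bullet> y)) * null_functional a b y ^ l)"
    and "(\<integral>y. of_real (k (x \<bullet> y)) * null_functional a b y ^ l \<partial>sphere_measure)
      = 2 * pi * of_real (LINT t:{-1..1}|lebesgue. k t * poly (legendre_poly l) t) * null_functional a b x ^ l"
proof -
  let ?L = "null_functional a b"
  define k0 where "k0 t = indicator {-1..1} t * k t" for t
  have k0: "integrable lebesgue k0"
    using k by (simp add: set_integrable_def k0_def[abs_def])
  then have k0m: "k0 \<in> borel_measurable lebesgue" by simp
  then obtain k' where k': "k' \<in> borel_measurable lborel" and eq: "AE t in lborel. k0 t = k' t"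
    using completion_ex_borel_measurable_real by blast
  have k'm [measurable]: "k' \<in> borel_measurable borel" using k' by simp
  have eq': "AE t in lebesgue. k0 t = k' t" using eq by (rule AE_completion)
  have "integrable lebesgue k'"
    using k0 k' integrable_cong_AE[OF k0m measurable_completion[OF k'] eq'] by simp
  then have "integrable lborel k'"
    using k' by (simp add: integrable_completion)
  then have k'i: "integrable lborel (\<lambda>t. indicator {-1..1} t * k' t)"
    using integrable_mult_indicator[of "{-1..1}" lborel k'] by simp
  have ae: "AE y in sphere_measure. of_real (k (x \<bullet> y)) * ?L y ^ l = of_real (k' (x \<bullet> y)) * ?L y ^ l"
  proof (rule AE_sphere_measure_I)
    show "AE y in borel_sphere_measure. of_real (k (x \<bullet> y)) * ?L y ^ l = of_real (k' (x \<bullet> y)) * ?L y ^ l"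
      using AE_inner_sphere_measure[OF x eq] AE_norm_borel_sphere_measure
    proof eventually_elim
      case (elim y)
      have "\<bar>x \<bullet> y\<bar> \<le> 1" using Cauchy_Schwarz_ineq2[of x y] x elim by simp
      then show ?case using elim by (simp add: k0_def abs_le_iff)
    qed
  qed
  have m': "(\<lambda>y. of_real (k' (x \<bullet> y)) * ?L y ^ l) \<in> borel_measurable borel" by measurable
  have m: "(\<lambda>y. of_real (k (x \<bullet> y)) * ?L y ^ l) \<in> borel_measurable sphere_measure"
  proof (rule measurable_cong[THEN iffD2])
    fix y assume "y \<in> space sphere_measure"
    then have "\<bar>x \<bullet> y\<bar> \<le> 1"
      using Cauchy_Schwarz_ineq2[of x y] x by (simp add: space_sphere_measure)
    then show "of_real (k (x \<bullet> y)) * ?L y ^ l = of_real (k0 (x \<bullet> y)) * ?L y ^ l"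
      by (simp add: k0_def abs_le_iff)
  next
    have "(\<lambda>y. k0 (x \<bullet> y)) \<in> borel_measurable sphere_measure"
      using measurable_compose[OF measurable_inner_sphere_measure[OF x] k0m] .
    moreover have "?L \<in> borel_measurable sphere_measure"
      by (intro sphere_measure_borel) simp
    ultimately show "(\<lambda>y. of_real (k0 (x \<bullet> y)) * ?L y ^ l) \<in> borel_measurable sphere_measure"
      by measurable
  qed
  show "integrable sphere_measure (\<lambda>y. of_real (k (x \<bullet> y)) * ?L y ^ l)"
    using integrable_cong_AE[OF m sphere_measure_borel(1)[OF m'] ae] sphere_measure_borel(2)[OF m']
      funk_hecke_null_power(1)[OF k'i k'm x ab] by simp
  have "(LINT t:{-1..1}|lebesgue. k t * poly (legendre_poly l) t)
      = (\<integral>t. indicator {-1..1} t * (k' t * poly (legendre_poly l) t) \<partial>lebesgue)"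
    unfolding set_lebesgue_integral_def
  proof (rule integral_cong_AE)
    have "(\<lambda>t. k0 t * poly (legendre_poly l) t) \<in> borel_measurable lebesgue"
      by (intro borel_measurable_times k0m measurable_completion) simp
    then show "(\<lambda>t. indicator {-1..1} t *\<^sub>R (k t * poly (legendre_poly l) t)) \<in> borel_measurable lebesgue"
      by (simp add: k0_def mult.assoc)
    show "(\<lambda>t. indicator {-1..1} t * (k' t * poly (legendre_poly l) t)) \<in> borel_measurable lebesgue"
      by (intro measurable_completion) simp
    show "AE t in lebesgue. indicator {-1..1} t *\<^sub>R (k t * poly (legendre_poly l) t)
        = indicator {-1..1} t * (k' t * poly (legendre_poly l) t)"
      using eq' by eventually_elim (auto simp: k0_def indicator_def)
  qed
  also have "\<dots> = (\<integral>t. indicator {-1..1} t * (k' t * poly (legendre_poly l) t) \<partial>lborel)"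
    by (rule integral_completion) simp
  finally have "(LINT t:{-1..1}|lebesgue. k t * poly (legendre_poly l) t) = \<dots>" .
  then show "(\<integral>y. of_real (k (x \<bullet> y)) * ?L y ^ l \<partial>sphere_measure)
      = 2 * pi * of_real (LINT t:{-1..1}|lebesgue. k t * poly (legendre_poly l) t) * ?L x ^ l"
    using integral_cong_AE[OF m sphere_measure_borel(1)[OF m'] ae] sphere_measure_borel(3)[OF m']
      funk_hecke_null_power(2)[OF k'i k'm x ab] by simp
qed

lemma funk_hecke:
  fixes k :: "real \<Rightarrow> real" and x :: "real ^ 3"
  assumes k: "set_integrable lebesgue {-1..1} k" and x: "norm x = 1" and m: "\<bar>m\<bar> \<le> int l"
  shows "integrable sphere_measure (\<lambda>y. of_real (k (x \<bullet> y)) * spherical_harmonic l m y)"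
    and "(\<integral>y. of_real (k (x \<bullet> y)) * spherical_harmonic l m y \<partial>sphere_measure)
      = 2 * pi * of_real (LINT t:{-1..1}|lebesgue. k t * poly (legendre_poly l) t) * spherical_harmonic l m x"
proof -
  define L where "L j = null_functional (axis 3 1) (harmonic_direction (node (2 * l + 1) j))" for j
  have FH: "integrable sphere_measure (\<lambda>y. of_real (k (x \<bullet> y)) * L j y ^ l)"
    "(\<integral>y. of_real (k (x \<bullet> y)) * L j y ^ l \<partial>sphere_measure)
      = 2 * pi * of_real (LINT t:{-1..1}|lebesgue. k t * poly (legendre_poly l) t) * L j x ^ l" for j
    unfolding L_def by (rule funk_hecke_null_power_lebesgue[OF k x null_pair_harmonic_direction])+
  have Y: "spherical_harmonic l m y = (\<Sum>j<2*l+1. harmonic_weight l m j * L j y ^ l)" if "norm y = 1" for y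
    unfolding L_def by (rule spherical_harmonic_sum_null_powers[OF m that])
  have eq: "of_real (k (x \<bullet> y)) * spherical_harmonic l m y
      = (\<Sum>j<2*l+1. harmonic_weight l m j * (of_real (k (x \<bullet> y)) * L j y ^ l))" if "y \<in> space sphere_measure" for y
  proof -
    have "norm y = 1" using that by (simp add: space_sphere_measure)
    then show ?thesis unfolding Y[OF \<open>norm y = 1\<close>] sum_distrib_left by (simp only: mult_ac)
  qed
  show "integrable sphere_measure (\<lambda>y. of_real (k (x \<bullet> y)) * spherical_harmonic l m y)"
    by (subst Bochner_Integration.integrable_cong[OF refl eq], assumption)
      (intro Bochner_Integration.integrable_sum integrable_mult_right FH(1))
  have "(\<integral>y. of_real (k (x \<bullet> y)) * spherical_harmonic l m y \<partial>sphere_measure)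
     = (\<integral>y. (\<Sum>j<2*l+1. harmonic_weight l m j * (of_real (k (x \<bullet> y)) * L j y ^ l)) \<partial>sphere_measure)"
    by (rule Bochner_Integration.integral_cong[OF refl eq])
  also have "\<dots> = (\<Sum>j<2*l+1. \<integral>y. harmonic_weight l m j * (of_real (k (x \<bullet> y)) * L j y ^ l) \<partial>sphere_measure)"
    by (rule Bochner_Integration.integral_sum) (intro integrable_mult_right FH(1))
  also have "\<dots> = (\<Sum>j<2*l+1. harmonic_weight l m j * (2 * pi * of_real (LINT t:{-1..1}|lebesgue. k t * poly (legendre_poly l) t) * L j x ^ l))"
    by (simp only: integral_mult_right_zero FH(2))
  also have "\<dots> = 2 * pi * of_real (LINT t:{-1..1}|lebesgue. k t * poly (legendre_poly l) t) * spherical_harmonic l m x"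
    unfolding Y[OF x] sum_distrib_left by (simp only: mult_ac)
  finally show "(\<integral>y. of_real (k (x \<bullet> y)) * spherical_harmonic l m y \<partial>sphere_measure)
      = 2 * pi * of_real (LINT t:{-1..1}|lebesgue. k t * poly (legendre_poly l) t) * spherical_harmonic l m x" .
qed

section \<open>The principal value and the eigenvalue equation\<close>

lemma dist_sphere:
  fixes x y :: "'a :: real_inner"
  assumes "norm x = 1" "norm y = 1"
  shows "dist x y = sqrt (2 * (1 - x \<bullet> y))"
proof -
  have "x \<bullet> x = 1" "y \<bullet> y = 1" using assms by (simp_all add: norm_eq_1)
  then show ?thesis
    by (simp add: dist_norm norm_eq_sqrt_inner inner_diff_left inner_diff_right inner_commute)
qed

lemma legendre_poly_0: "legendre_poly 0 = 1"
  by (simp add: legendre_poly_def)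

text \<open>The factor \<open>1 - t\<close> compensates the singularity of the kernel at \<open>t = 1\<close>, since only the product of the
  kernel with \<open>1 - t\<close> is assumed integrable.\<close>

lemma legendre_poly_minus_1_factor:
  obtains r where "\<And>t. poly (legendre_poly l) t - 1 = - (1 - t) * poly r t"
proof -
  have "poly (legendre_poly l - 1) 1 = 0" by simp
  then have "[:-1, 1:] dvd legendre_poly l - 1"
    by (simp only: poly_eq_0_iff_dvd)
  then obtain r where r: "legendre_poly l - 1 = [:-1, 1:] * r"
    by (rule dvdE)
  then have "poly (legendre_poly l) t - 1 = - (1 - t) * poly r t" for t
    using arg_cong[OF r, of "\<lambda>p. poly p t"] by (simp add: algebra_simps)
  then show ?thesis by (rule that)
qed

text \<open>Away from \<open>t = 1\<close> the factor \<open>1 - t\<close> is bounded below.\<close>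

lemma set_integrable_truncated_kernel:
  fixes h :: "real \<Rightarrow> real"
  assumes h: "set_integrable lebesgue {-1..1} (\<lambda>t. (1 - t) * h t)" and c: "c < 1"
  shows "set_integrable lebesgue {-1..1} (\<lambda>t. indicator {..c} t * h t)"
  unfolding set_integrable_def
proof (rule Bochner_Integration.integrable_bound)
  let ?g = "\<lambda>t. indicator {-1..1} t *\<^sub>R ((1 - t) * h t)" and ?q = "\<lambda>t. indicator {..c} t / (1 - t)"
  show "integrable lebesgue (\<lambda>t. (1 / (1 - c)) * ?g t)"
    using h by (simp add: set_integrable_def)
  have eq: "indicator {-1..1} t *\<^sub>R (indicator {..c} t * h t) = ?g t * ?q t" for t
    using c by (auto simp: indicator_def)
  have "?g \<in> borel_measurable lebesgue" using h by (auto simp: set_integrable_def)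
  moreover have "?q \<in> borel_measurable lebesgue" by (intro measurable_completion) simp
  ultimately show "(\<lambda>t. indicator {-1..1} t *\<^sub>R (indicator {..c} t * h t)) \<in> borel_measurable lebesgue"
    unfolding eq by (rule borel_measurable_times)
  have "\<bar>?q t\<bar> \<le> 1 / (1 - c)" for t
    using c by (auto simp: indicator_def frac_le)
  then have "\<bar>?g t * ?q t\<bar> \<le> \<bar>1 / (1 - c) * ?g t\<bar>" for t
    using c mult_right_mono[of "\<bar>?q t\<bar>" "1 / (1 - c)" "\<bar>?g t\<bar>"] by (simp only: abs_mult mult.commute) simp
  then show "AE t in lebesgue. norm (indicator {-1..1} t *\<^sub>R (indicator {..c} t * h t)) \<le> norm ((1 / (1 - c)) * ?g t)"
    unfolding eq by (intro AE_I2) simp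
qed

text \<open>Dominated convergence. The cut-off always removes the point \<open>t = 1\<close>, where the pointwise limit
  is the value of \<open>w\<close> only because this value is \<open>0\<close>.\<close>

lemma tendsto_truncated_integral:
  fixes w :: "real \<Rightarrow> real"
  assumes w: "set_integrable lebesgue {-1..1} w" and w1: "w 1 = 0"
  shows "((\<lambda>\<epsilon>. LINT t:{-1..1}|lebesgue. indicator {..cos \<epsilon>} t * w t) \<longlongrightarrow> (LINT t:{-1..1}|lebesgue. w t)) (at_right 0)"
  unfolding tendsto_at_iff_sequentially o_def
proof (intro allI impI)
  fix X :: "nat \<Rightarrow> real" assume "\<forall>i. X i \<in> {0<..} - {0}" and X: "X \<longlonglongrightarrow> 0"
  have cosX: "(\<lambda>n. cos (X n)) \<longlonglongrightarrow> 1"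
    using tendsto_cos[OF X] by simp
  show "(\<lambda>n. LINT t:{-1..1}|lebesgue. indicator {..cos (X n)} t * w t) \<longlonglongrightarrow> (LINT t:{-1..1}|lebesgue. w t)"
    unfolding set_lebesgue_integral_def
  proof (rule integral_dominated_convergence[where w = "\<lambda>t. \<bar>indicator {-1..1} t *\<^sub>R w t\<bar>"])
    have wm: "(\<lambda>t. indicator {-1..1} t *\<^sub>R w t) \<in> borel_measurable lebesgue"
      using w by (auto simp: set_integrable_def)
    then show "(\<lambda>t. indicator {-1..1} t *\<^sub>R w t) \<in> borel_measurable lebesgue" .
    show "integrable lebesgue (\<lambda>t. \<bar>indicator {-1..1} t *\<^sub>R w t\<bar>)"
      using w unfolding set_integrable_def by (rule integrable_abs)
    show "(\<lambda>t. indicator {-1..1} t *\<^sub>R (indicator {..cos (X n)} t * w t)) \<in> borel_measurable lebesgue" for n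
    proof -
      have "(\<lambda>t. indicator {..cos (X n)} t * (indicator {-1..1} t *\<^sub>R w t)) \<in> borel_measurable lebesgue"
        by (intro borel_measurable_times wm measurable_completion) simp
      then show ?thesis by (simp add: mult_ac)
    qed
    show "AE t in lebesgue. norm (indicator {-1..1} t *\<^sub>R (indicator {..cos (X n)} t * w t)) \<le> \<bar>indicator {-1..1} t *\<^sub>R w t\<bar>" for n
      by (intro AE_I2) (auto simp: indicator_def)
    show "AE t in lebesgue. (\<lambda>n. indicator {-1..1} t *\<^sub>R (indicator {..cos (X n)} t * w t)) \<longlonglongrightarrow> indicator {-1..1} t *\<^sub>R w t"
    proof (rule AE_I2)
      fix t :: real
      show "(\<lambda>n. indicator {-1..1} t *\<^sub>R (indicator {..cos (X n)} t * w t)) \<longlonglongrightarrow> indicator {-1..1} t *\<^sub>R w t"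
      proof (cases "t < 1")
        case True
        from order_tendstoD(1)[OF cosX this]
        have "eventually (\<lambda>n. indicator {-1..1} t *\<^sub>R (indicator {..cos (X n)} t * w t) = indicator {-1..1} t *\<^sub>R w t) sequentially"
          by eventually_elim (simp add: indicator_def)
        then show ?thesis by (rule tendsto_eventually)
      next
        case False
        then have "t = 1 \<or> t \<notin> {-1..1}" by auto
        then show ?thesis using w1 by (auto simp: indicator_def)
      qed
    qed
  qed
qed

text \<open>The Funk--Hecke formula applied separately to \<open>Y(y)\<close> and to the constant \<open>Y(x)\<close>; the latter is a
  multiple of the zeroth power of a null functional.\<close>

lemma nonlocal_LB_truncated_spherical_harmonic:
  fixes \<rho> :: "real \<Rightarrow> real"
  defines "h \<equiv> \<lambda>t. \<rho> (sqrt (2 * (1 - t)))"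
  assumes h: "set_integrable lebesgue {-1..1} (\<lambda>t. (1 - t) * h t)"
    and m: "\<bar>m\<bar> \<le> int l" and x: "norm x = 1" and \<epsilon>: "0 < \<epsilon>" "\<epsilon> < pi"
  shows "set_integrable sphere_measure {y \<in> sphere 0 1. x \<bullet> y \<le> cos \<epsilon>}
          (\<lambda>y. of_real (\<rho> (dist x y)) * (spherical_harmonic l m y - spherical_harmonic l m x))"
    and "nonlocal_LB_truncated \<rho> (spherical_harmonic l m) x \<epsilon>
      = 2 * pi * of_real (LINT t:{-1..1}|lebesgue. indicator {..cos \<epsilon>} t * ((poly (legendre_poly l) t - 1) * h t))
        * spherical_harmonic l m x"
proof -
  let ?Y = "spherical_harmonic l m" and ?P = "poly (legendre_poly l)"
  define k where "k t = indicator {..cos \<epsilon>} t * h t" for t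
  have "cos \<epsilon> < 1" using cos_monotone_0_pi[of 0 \<epsilon>] \<epsilon> by simp
  then have k: "set_integrable lebesgue {-1..1} k"
    unfolding k_def by (rule set_integrable_truncated_kernel[OF h])
  note Y = funk_hecke[OF k x m]
  have one: "integrable sphere_measure (\<lambda>y. complex_of_real (k (x \<bullet> y)))"
    "(\<integral>y. complex_of_real (k (x \<bullet> y)) \<partial>sphere_measure) = 2 * pi * of_real (LINT t:{-1..1}|lebesgue. k t)"
    using funk_hecke_null_power_lebesgue[OF k x null_pair_harmonic_direction, of 0 0] by (simp_all add: legendre_poly_0)
  have eq: "indicator {y \<in> sphere 0 1. x \<bullet> y \<le> cos \<epsilon>} y *\<^sub>R (of_real (\<rho> (dist x y)) * (?Y y - ?Y x))
     = of_real (k (x \<bullet> y)) * ?Y y - of_real (k (x \<bullet> y)) * ?Y x" if "y \<in> space sphere_measure" for y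
    using that x by (auto simp: space_sphere_measure k_def h_def dist_sphere indicator_def algebra_simps)
  show "set_integrable sphere_measure {y \<in> sphere 0 1. x \<bullet> y \<le> cos \<epsilon>}
          (\<lambda>y. of_real (\<rho> (dist x y)) * (?Y y - ?Y x))"
    unfolding set_integrable_def
    by (subst Bochner_Integration.integrable_cong[OF refl eq]) (auto intro!: Y(1) one(1) Bochner_Integration.integrable_diff integrable_mult_left)
  have "nonlocal_LB_truncated \<rho> ?Y x \<epsilon>
     = (\<integral>y. of_real (k (x \<bullet> y)) * ?Y y - of_real (k (x \<bullet> y)) * ?Y x \<partial>sphere_measure)"
    unfolding nonlocal_LB_truncated_def set_lebesgue_integral_def
    by (rule Bochner_Integration.integral_cong[OF refl eq])
  also have "\<dots> = (\<integral>y. of_real (k (x \<bullet> y)) * ?Y y \<partial>sphere_measure)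
      - (\<integral>y. of_real (k (x \<bullet> y)) * ?Y x \<partial>sphere_measure)"
    by (intro Bochner_Integration.integral_diff Y(1) one(1) integrable_mult_left)
  also have "(\<integral>y. of_real (k (x \<bullet> y)) * ?Y x \<partial>sphere_measure) = 2 * pi * of_real (LINT t:{-1..1}|lebesgue. k t) * ?Y x"
    by (simp only: integral_mult_left_zero one(2))
  also have "(\<integral>y. of_real (k (x \<bullet> y)) * ?Y y \<partial>sphere_measure) - \<dots>
      = 2 * pi * of_real ((LINT t:{-1..1}|lebesgue. k t * ?P t) - (LINT t:{-1..1}|lebesgue. k t)) * ?Y x"
    unfolding Y(2) by (simp add: algebra_simps)
  also have "(LINT t:{-1..1}|lebesgue. k t * ?P t) - (LINT t:{-1..1}|lebesgue. k t)
      = (LINT t:{-1..1}|lebesgue. k t * ?P t - k t)"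
    by (intro set_integral_diff(2)[symmetric] set_integrable_mult_poly k measurable_completion) simp
  also have "(\<lambda>t. k t * ?P t - k t) = (\<lambda>t. indicator {..cos \<epsilon>} t * ((?P t - 1) * h t))"
    by (simp add: k_def algebra_simps)
  finally show "nonlocal_LB_truncated \<rho> ?Y x \<epsilon>
      = 2 * pi * of_real (LINT t:{-1..1}|lebesgue. indicator {..cos \<epsilon>} t * ((?P t - 1) * h t)) * ?Y x" .
qed

lemma spherical_harmonic_eigenfunction:
  assumes adm: "admissible_kernel \<rho>" and m: "\<bar>m\<bar> \<le> int l"
  shows "nonlocal_LB_eigenfunction \<rho> (spherical_harmonic l m)
    (2 * pi * (LINT t:{-1..1}|lebesgue. (poly (legendre_poly l) t - 1) * \<rho> (sqrt (2 * (1 - t)))))"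
  unfolding nonlocal_LB_eigenfunction_def
proof (intro conjI ballI)
  let ?Y = "spherical_harmonic l m"
  let ?w = "\<lambda>t. (poly (legendre_poly l) t - 1) * \<rho> (sqrt (2 * (1 - t)))"
  let ?I = "LINT t:{-1..1}|lebesgue. ?w t"
  show "\<exists>x\<in>sphere 0 1. ?Y x \<noteq> 0" using m by (rule spherical_harmonic_nonzero)
  have h: "set_integrable lebesgue {-1..1} (\<lambda>t. (1 - t) * \<rho> (sqrt (2 * (1 - t))))"
    using adm by (simp add: admissible_kernel_def)
  obtain r where r: "\<And>t. poly (legendre_poly l) t - 1 = - (1 - t) * poly r t"
    by (rule legendre_poly_minus_1_factor) blast
  have "set_integrable lebesgue {-1..1} (\<lambda>t. ((1 - t) * \<rho> (sqrt (2 * (1 - t)))) * poly (- r) t)"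
    by (intro set_integrable_mult_poly h measurable_completion) simp
  moreover have "(\<lambda>t. ((1 - t) * \<rho> (sqrt (2 * (1 - t)))) * poly (- r) t) = ?w"
    by (simp only: r poly_minus mult_minus_left mult_minus_right mult_ac)
  ultimately have w: "set_integrable lebesgue {-1..1} ?w"
    by (simp only:)
  fix x :: "real ^ 3" assume "x \<in> sphere 0 1"
  then have x: "norm x = 1" by simp
  note trunc = nonlocal_LB_truncated_spherical_harmonic[OF h m x]
  have "((\<lambda>\<epsilon>. 2 * pi * of_real (LINT t:{-1..1}|lebesgue. indicator {..cos \<epsilon>} t * ?w t) * ?Y x)
      \<longlongrightarrow> 2 * pi * of_real ?I * ?Y x) (at_right 0)"
    by (intro tendsto_intros tendsto_truncated_integral w) simp
  moreover have "eventually (\<lambda>\<epsilon>. 0 < \<epsilon> \<and> \<epsilon> < pi) (at_right 0)"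
    by (auto simp: eventually_at_right[of 0 pi] intro: exI[of _ pi])
  then have "eventually (\<lambda>\<epsilon>. 2 * pi * of_real (LINT t:{-1..1}|lebesgue. indicator {..cos \<epsilon>} t * ?w t) * ?Y x
      = nonlocal_LB_truncated \<rho> ?Y x \<epsilon>) (at_right 0)"
    by eventually_elim (simp add: trunc(2))
  ultimately have lim: "(nonlocal_LB_truncated \<rho> ?Y x \<longlongrightarrow> 2 * pi * of_real ?I * ?Y x) (at_right 0)"
    by (rule Lim_transform_eventually)
  then show "nonlocal_LB_exists \<rho> ?Y x"
    unfolding nonlocal_LB_exists_def using trunc(1) by blast
  show "nonlocal_LB \<rho> ?Y x = of_real (2 * pi * ?I) * ?Y x"
    unfolding nonlocal_LB_def using tendsto_Lim[OF _ lim] by simp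
qed

section \<open>The power kernel\<close>

lemma set_integrable_one_minus_powr:
  fixes \<alpha> :: real
  assumes "-1 < \<alpha>"
  shows "set_integrable lborel {-1..1} (\<lambda>t. (1 - t) powr \<alpha>)"
proof -
  have "(\<lambda>u. u powr \<alpha>) absolutely_integrable_on {0..2::real}"
    using integrable_on_powr_from_0[OF assms, of 2] by (intro nonnegative_absolutely_integrable_1) auto
  then have "integrable lebesgue (\<lambda>u. indicator {0..2} u *\<^sub>R u powr \<alpha>)"
    by (simp add: set_integrable_def)
  then have "integrable lborel (\<lambda>u. indicator {0..2} u *\<^sub>R u powr \<alpha>)"
    by (subst (asm) integrable_completion) simp_all
  from lborel_integrable_real_affine[OF this, of "-1" 1]
  have "integrable lborel (\<lambda>t. indicator {0..2} (1 - t) *\<^sub>R (1 - t) powr \<alpha>)" by simp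
  also have "(\<lambda>t :: real. indicator {0..2} (1 - t) *\<^sub>R (1 - t) powr \<alpha>) = (\<lambda>t. indicator {-1..1} t *\<^sub>R (1 - t) powr \<alpha>)"
    by (auto simp: indicator_def fun_eq_iff)
  finally show ?thesis by (simp add: set_integrable_def)
qed

text \<open>The weighted profile is a bounded multiple of \<open>(1 - t)\<close> raised to \<open>\<alpha> > -1\<close>.\<close>

lemma admissible_power_kernel:
  fixes \<alpha> \<delta> K :: real
  assumes \<alpha>: "-1 < \<alpha>"
    and \<rho>: "\<And>t. t \<in> {-1..<1} \<Longrightarrow> \<rho> (sqrt (2 * (1 - t))) = K / (c * (1 - t) powr (1 - \<alpha>)) * indicator {0..\<delta>} (sqrt (2 * (1 - t)))"
  shows "admissible_kernel \<rho>"
  unfolding admissible_kernel_def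
proof
  let ?g = "\<lambda>s. K / (c * (s\<^sup>2 / 2) powr (1 - \<alpha>)) * indicator {0..\<delta>} s"
  show "\<rho> \<in> borel_measurable (lebesgue_on {0<..2})"
  proof (rule measurable_cong[THEN iffD2])
    fix s :: real assume "s \<in> space (lebesgue_on {0<..2})"
    then have s: "0 < s" "s \<le> 2" by auto
    then have "s\<^sup>2 \<le> 2\<^sup>2" by (intro power_mono) auto
    moreover have "0 < s\<^sup>2" using s by simp
    ultimately show "\<rho> s = ?g s"
      using \<rho>[of "1 - s\<^sup>2 / 2"] s by simp
  next
    have "?g \<in> borel_measurable lebesgue"
      by (intro measurable_completion) simp
    then show "?g \<in> borel_measurable (lebesgue_on {0<..2})"
      by (rule measurable_restrict_space1)
  qed
  let ?f = "\<lambda>t. (1 - t) powr \<alpha> * (K / c * indicator {0..\<delta>} (sqrt (2 * (1 - t))))"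
  have i: "integrable lborel (\<lambda>t. (K / c) * (indicator {-1..1} t *\<^sub>R (1 - t) powr \<alpha>))"
    using set_integrable_one_minus_powr[OF \<alpha>] by (simp add: set_integrable_def)
  have "integrable lborel (\<lambda>t. indicator {-1..1} t *\<^sub>R ?f t)"
    by (rule Bochner_Integration.integrable_bound[OF i])
      (auto simp: indicator_def abs_mult mult_ac)
  then have "integrable lebesgue (\<lambda>t. indicator {-1..1} t *\<^sub>R ?f t)"
    by (subst integrable_completion) simp_all
  moreover have "indicator {-1..1} t *\<^sub>R ?f t = indicator {-1..1} t *\<^sub>R ((1 - t) * \<rho> (sqrt (2 * (1 - t))))" for t
  proof (cases "t \<in> {-1..<1}")
    case True
    then have "(1 - t) / (1 - t) powr (1 - \<alpha>) = (1 - t) powr \<alpha>"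
      by (simp add: powr_diff)
    moreover have "(1 - t) * (K / (c * p) * i) = (1 - t) / p * (K / c * i)" for p i :: real
      by (simp add: mult_ac)
    ultimately show ?thesis using True by (simp only: \<rho>[OF True])
  next
    case False
    then have "t = 1 \<or> t \<notin> {-1..1}" by auto
    then show ?thesis by auto
  qed
  ultimately show "set_integrable lebesgue {-1..1} (\<lambda>t. (1 - t) * \<rho> (sqrt (2 * (1 - t))))"
    by (simp add: set_integrable_def)
qed

section \<open>The eigenvalue theorem\<close>

theorem mainTheorem1:
  fixes \<delta> :: real
  assumes "0 < \<delta>" and "\<delta> \<le> 2"
  shows "(\<forall>\<rho> :: real \<Rightarrow> real. admissible_kernel \<rho> \<longrightarrow>
            (\<forall>(l :: nat) (m :: int). - int l \<le> m \<and> m \<le> int l \<longrightarrow>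
               nonlocal_LB_eigenfunction \<rho> (spherical_harmonic l m)
                 (2 * pi * (LINT t:{-1..1}|lebesgue.
                    (poly (legendre_poly l) t - 1) * \<rho> (sqrt (2 * (1 - t)))))))
       \<and> (\<forall>(\<alpha> :: real) (\<rho> :: real \<Rightarrow> real). -1 < \<alpha> \<and> \<alpha> < 1 \<and>
            (\<forall>t \<in> {-1..<1}. \<rho> (sqrt (2 * (1 - t))) =
               (1 + \<alpha>) * 2 powr (1 + \<alpha>) / (pi * \<delta> powr (2 + 2 * \<alpha>) * (1 - t) powr (1 - \<alpha>))
                 * indicator {0..\<delta>} (sqrt (2 * (1 - t)))) \<longrightarrow>
            admissible_kernel \<rho> \<and>
            (\<forall>(l :: nat) (m :: int). - int l \<le> m \<and> m \<le> int l \<longrightarrow>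
               nonlocal_LB_eigenfunction \<rho> (spherical_harmonic l m)
                 (2 * pi * (LINT t:{1 - \<delta>\<^sup>2 / 2..1}|lebesgue.
                    (poly (legendre_poly l) t - 1) * \<rho> (sqrt (2 * (1 - t)))))))"
proof (intro conjI allI impI; (elim conjE)?)
  fix \<rho> :: "real \<Rightarrow> real" and l :: nat and m :: int
  assume "admissible_kernel \<rho>" "- int l \<le> m" "m \<le> int l"
  then show "nonlocal_LB_eigenfunction \<rho> (spherical_harmonic l m)
      (2 * pi * (LINT t:{-1..1}|lebesgue. (poly (legendre_poly l) t - 1) * \<rho> (sqrt (2 * (1 - t)))))"
    by (intro spherical_harmonic_eigenfunction) auto
next
  fix \<alpha> :: real and \<rho> :: "real \<Rightarrow> real"
  assume \<alpha>: "-1 < \<alpha>" and \<rho>: "\<forall>t \<in> {-1..<1}. \<rho> (sqrt (2 * (1 - t))) =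
      (1 + \<alpha>) * 2 powr (1 + \<alpha>) / (pi * \<delta> powr (2 + 2 * \<alpha>) * (1 - t) powr (1 - \<alpha>))
        * indicator {0..\<delta>} (sqrt (2 * (1 - t)))"
  show adm: "admissible_kernel \<rho>"
    using \<rho> by (intro admissible_power_kernel[OF \<alpha>]) blast
  fix l :: nat and m :: int
  assume m: "- int l \<le> m" "m \<le> int l"
  let ?w = "\<lambda>t. (poly (legendre_poly l) t - 1) * \<rho> (sqrt (2 * (1 - t)))"
  have "\<delta>\<^sup>2 \<le> 2\<^sup>2" using assms by (intro power_mono) auto
  then have d: "-1 \<le> 1 - \<delta>\<^sup>2 / 2" by simp
  have zero: "\<rho> (sqrt (2 * (1 - t))) = 0" if "-1 \<le> t" "t < 1 - \<delta>\<^sup>2 / 2" for t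
  proof -
    have "\<delta> < sqrt (2 * (1 - t))" using that by (intro real_less_rsqrt) simp
    moreover have "t < 1" using that by (smt (verit) zero_le_power2 divide_nonneg_pos)
    ultimately show ?thesis using \<rho> that by simp
  qed
  have "(LINT t:{-1..1}|lebesgue. ?w t) = (LINT t:{1 - \<delta>\<^sup>2 / 2..1}|lebesgue. ?w t)"
    unfolding set_lebesgue_integral_def
  proof (intro Bochner_Integration.integral_cong refl)
    fix t :: real
    show "indicator {-1..1} t *\<^sub>R ?w t = indicator {1 - \<delta>\<^sup>2 / 2..1} t *\<^sub>R ?w t"
      using d zero[of t] by (auto simp: indicator_def)
  qed
  then show "nonlocal_LB_eigenfunction \<rho> (spherical_harmonic l m)
      (2 * pi * (LINT t:{1 - \<delta>\<^sup>2 / 2..1}|lebesgue. ?w t))"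
    using spherical_harmonic_eigenfunction[OF adm, of m l] m by simp
qed

end
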